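(* Let $L>0$ and $T=nL$ for some $n\in\mathbb{N}$. Let $\Sigma_H$ be a uniform mesh of $\Sigma$ such that $jL$, $j=0,\dots,n$, are nodes of $\Sigma_H$ at $x=0$ and at $x=L$, and let $\Sigma_h$ be the fine mesh obtained by decomposing each element of $\Sigma_H$ into $m$ equal sized elements, where $m\in\mathbb{N}$, $m>2$. Let $g\in L^2(\Sigma)$, let $w\in[H^1_{,0}(\Sigma)]'$ be the unique solution of $\mathsf{V}w=g$, and let $(p_h,w_H)\in\mathcal{S}_h^0(\Sigma)\times\mathcal{S}_H^0(\Sigma)$ be the unique solution of the mixed boundary element formulation $$\langle p_h,q_h\rangle_{L^2(\Sigma)}+\langle\mathsf{V}w_H,q_h\rangle_{L^2(\Sigma)} = \langle g,q_h\rangle_{L^2(\Sigma)},\qquad \langle p_h,\mathsf{V}v_H\rangle_{L^2(\Sigma)}=0$$ for all $q_h\in\mathcal{S}_h^0(\Sigma)$ and all $v_H\in\mathcal{S}_H^0(\Sigma)$. Then $$\|w-w_H\|_{[H^1_{,0}(\Sigma)]'}\le\left(1+\frac{2m\,c_2^{\mathsf{V}}}{\sin\left(\frac{\pi}{2(2n+1)}\right)(m-2)}\right)\inf_{v_H\in\mathcal{S}_H^0(\Sigma)}\|w-v_H\|_{[H^1_{,0}(\Sigma)]'}.$$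
   Context: All functions are real-valued. $L^2(\Sigma) := L^2(0,T)\times L^2(0,T)$ and $H^1_{,0}(\Sigma) := H^1_{,0}(0,T)\times H^1_{,0}(0,T)$, where $H^1_{,0}(0,T)=\{q\in H^1(0,T): q(T)=0\}$; elements are written $u=(u_0,u_L)$, with $\|u\|^2_{L^2(\Sigma)} = \|u_0\|^2_{L^2(0,T)}+\|u_L\|^2_{L^2(0,T)}$ and $\|u\|^2_{H^1_{,0}(\Sigma)} := \|\partial_t u_0\|^2_{L^2(0,T)}+\|\partial_t u_L\|^2_{L^2(0,T)}$. $[H^1_{,0}(\Sigma)]'$ is the dual of $H^1_{,0}(\Sigma)$ with respect to $L^2(\Sigma)$ (the pairing $\langle\cdot,\cdot\rangle_\Sigma$ extends the $L^2(\Sigma)$ inner product, so $L^2(\Sigma)\subset [H^1_{,0}(\Sigma)]'$), with norm $\|w\|_{[H^1_{,0}(\Sigma)]'} = \sup_{0\neq v\in H^1_{,0}(\Sigma)}\langle w,v\rangle_\Sigma/\|v\|_{H^1_{,0}(\Sigma)}$. The single layer boundary integral operator of the wave equation on $(0,L)\times(0,T)$ is, for $w=(w_0,w_L)\in L^2(\Sigma)$ and $t\in(0,T)$, $$(\mathsf{V}w)(t) = \begin{pmatrix} \frac12\int_0^t w_0(s)\,ds + \frac12\int_0^{t-L} w_L(s)\,ds\\[1mm] \frac12\int_0^{t-L} w_0(s)\,ds+\frac12\int_0^t w_L(s)\,ds\end{pmatrix},$$ where integrals $\int_0^{t-L}$ are understood as $0$ for $t\le L$. $\mathsf{V}:[H^1_{,0}(\Sigma)]'\to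 L^2(\Sigma)$ denotes its continuous extension, which is an isomorphism; $c_2^{\mathsf{V}}>0$ denotes its boundedness constant, i.e. $\|\mathsf{V}v\|_{L^2(\Sigma)}\le c_2^{\mathsf{V}}\|v\|_{[H^1_{,0}(\Sigma)]'}$ for all $v\in[H^1_{,0}(\Sigma)]'$. A mesh of $\Sigma$ consists of a decomposition of $(0,T)$ into finitely many intervals (elements) for the component at $x=0$ and another decomposition of $(0,T)$ for the component at $x=L$; it is uniform if all elements (of both components) have the same length. $\mathcal{S}_H^0(\Sigma)$ and $\mathcal{S}_h^0(\Sigma)$ are the spaces of functions in $L^2(\Sigma)$ that are piecewise constant with respect to $\Sigma_H$ and $\Sigma_h$, respectively. *)

theory Defs
  imports "HOL-Analysis.Analysis"
begin

text \<open>
  Elements of Lebesgue and Sobolev spaces on \<open>(0,T)\<close> are represented by functions on the reals;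
  only their values almost everywhere on \<open>(0,T)\<close> matter, so the norms below are seminorms on
  representatives. An element \<open>(u\<^sub>0, u\<^sub>L)\<close> over the lateral boundary is a pair of such functions.
\<close>

type_synonym bfun = "(real \<Rightarrow> real) \<times> (real \<Rightarrow> real)"

definition L2 :: "real \<Rightarrow> (real \<Rightarrow> real) set" where
  "L2 T = {f. f \<in> borel_measurable (lebesgue_on {0<..<T}) \<and>
              integrable (lebesgue_on {0<..<T}) (\<lambda>t. (f t)\<^sup>2)}"

definition L2_bd :: "real \<Rightarrow> bfun set" where
  "L2_bd T = L2 T \<times> L2 T"

definition inner_bd :: "real \<Rightarrow> bfun \<Rightarrow> bfun \<Rightarrow> real" where
  "inner_bd T u v =
     (LINT t|lebesgue_on {0<..<T}. fst u t * fst v t) +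
     (LINT t|lebesgue_on {0<..<T}. snd u t * snd v t)"

definition norm_bd :: "real \<Rightarrow> bfun \<Rightarrow> real" where
  "norm_bd T u = sqrt (inner_bd T u u)"

definition lincomb_bd :: "real \<Rightarrow> bfun \<Rightarrow> real \<Rightarrow> bfun \<Rightarrow> bfun" where
  "lincomb_bd a u b v = ((\<lambda>t. a * fst u t + b * fst v t), (\<lambda>t. a * snd u t + b * snd v t))"

definition diff_bd :: "bfun \<Rightarrow> bfun \<Rightarrow> bfun" where
  "diff_bd u v = lincomb_bd 1 u (-1) v"


text \<open>
  Weak derivative on \<open>(0,T)\<close>, tested against continuously differentiable functions with compact
  support in \<open>(0,T)\<close>. (This gives the same notion as smooth test functions.)
\<close>

definition weak_deriv :: "real \<Rightarrow> (real \<Rightarrow> real) \<Rightarrow> (real \<Rightarrow> real) \<Rightarrow> bool" where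
  "weak_deriv T q q' \<longleftrightarrow>
     (\<forall>\<phi> \<phi>'. (\<forall>t. (\<phi> has_real_derivative \<phi>' t) (at t)) \<and> continuous_on UNIV \<phi>' \<and>
             (\<exists>a b. 0 < a \<and> b < T \<and> (\<forall>t. t \<notin> {a..b} \<longrightarrow> \<phi> t = 0)) \<longrightarrow>
        (LINT t|lebesgue_on {0<..<T}. q t * \<phi>' t) = - (LINT t|lebesgue_on {0<..<T}. q' t * \<phi> t))"

text \<open>
  Every class in \<open>H\<^sup>1(0,T)\<close> has a unique representative that is continuous on \<open>[0,T]\<close>, and the
  end condition \<open>q(T) = 0\<close> refers to it; elements are given by that representative.
\<close>

definition H1_end0 :: "real \<Rightarrow> (real \<Rightarrow> real) set" where
  "H1_end0 T = {q \<in> L2 T. (\<exists>q' \<in> L2 T. weak_deriv T q q') \<and> continuous_on {0..T} q \<and> q T = 0}"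

definition dt :: "real \<Rightarrow> (real \<Rightarrow> real) \<Rightarrow> (real \<Rightarrow> real)" where
  "dt T q = (SOME q'. q' \<in> L2 T \<and> weak_deriv T q q')"

definition H1_bd :: "real \<Rightarrow> bfun set" where
  "H1_bd T = H1_end0 T \<times> H1_end0 T"

definition H1_norm_bd :: "real \<Rightarrow> bfun \<Rightarrow> real" where
  "H1_norm_bd T v = norm_bd T (dt T (fst v), dt T (snd v))"


text \<open>
  The dual of \<^term>\<open>H1_bd T\<close>. Only the values on \<^term>\<open>H1_bd T\<close> matter; boundedness makes a
  functional independent of the values of its argument outside \<open>[0,T]\<close>.
\<close>

definition H1_dual :: "real \<Rightarrow> (bfun \<Rightarrow> real) set" where
  "H1_dual T = {w.
     (\<forall>u \<in> H1_bd T. \<forall>v \<in> H1_bd T. \<forall>a b. w (lincomb_bd a u b v) = a * w u + b * w v) \<and>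
     (\<exists>C. \<forall>v \<in> H1_bd T. \<bar>w v\<bar> \<le> C * H1_norm_bd T v)}"

definition dual_norm :: "real \<Rightarrow> (bfun \<Rightarrow> real) \<Rightarrow> real" where
  "dual_norm T w =
     (SUP v \<in> {v \<in> H1_bd T. \<exists>t \<in> {0<..<T}. fst v t \<noteq> 0 \<or> snd v t \<noteq> 0}. w v / H1_norm_bd T v)"

text \<open>
  \<^term>\<open>dual_minus T w u\<close> is \<open>w - u\<close> for \<open>w\<close> in the dual and \<open>u\<close> in \<^term>\<open>L2_bd T\<close>, the latter
  being identified with the functional \<^term>\<open>inner_bd T u\<close>.
\<close>

definition dual_minus :: "real \<Rightarrow> (bfun \<Rightarrow> real) \<Rightarrow> bfun \<Rightarrow> (bfun \<Rightarrow> real)" where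
  "dual_minus T w u = (\<lambda>v. w v - inner_bd T u v)"


text \<open>The integration domain is empty, so the integral vanishes, when the upper limit is \<open>\<le> 0\<close>.\<close>

definition integral_0 :: "(real \<Rightarrow> real) \<Rightarrow> real \<Rightarrow> real" where
  "integral_0 f t = (LINT s|lebesgue_on {0<..<t}. f s)"

definition single_layer :: "real \<Rightarrow> bfun \<Rightarrow> bfun" where
  "single_layer L w =
     ((\<lambda>t. 1/2 * integral_0 (fst w) t + 1/2 * integral_0 (snd w) (t - L)),
      (\<lambda>t. 1/2 * integral_0 (fst w) (t - L) + 1/2 * integral_0 (snd w) t))"

text \<open>
  \<^term>\<open>single_layer_ext T L w g\<close> says that \<open>V w = g\<close> for the continuous extension \<open>V\<close> of
  \<^term>\<open>single_layer L\<close> from \<^term>\<open>L2_bd T\<close> (which is dense) to \<^term>\<open>H1_dual T\<close>: the value at \<open>w\<close> is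
  the limit of the values along a sequence in \<^term>\<open>L2_bd T\<close> approximating \<open>w\<close>. It is a relation
  because \<open>g\<close> is determined only almost everywhere.
\<close>

definition single_layer_ext :: "real \<Rightarrow> real \<Rightarrow> (bfun \<Rightarrow> real) \<Rightarrow> bfun \<Rightarrow> bool" where
  "single_layer_ext T L w g \<longleftrightarrow> w \<in> H1_dual T \<and> g \<in> L2_bd T \<and>
     (\<exists>u. (\<forall>k::nat. u k \<in> L2_bd T) \<and>
          (\<lambda>k. dual_norm T (dual_minus T w (u k))) \<longlonglongrightarrow> 0 \<and>
          (\<lambda>k. norm_bd T (diff_bd (single_layer L (u k)) g)) \<longlonglongrightarrow> 0)"


text \<open>A decomposition of \<open>(0,T)\<close> is given by its set of nodes; elements are pairs of neighbours.\<close>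

definition decomposition :: "real \<Rightarrow> real set \<Rightarrow> bool" where
  "decomposition T N \<longleftrightarrow> finite N \<and> N \<subseteq> {0..T} \<and> 0 \<in> N \<and> T \<in> N"

definition elements :: "real set \<Rightarrow> (real \<times> real) set" where
  "elements N = {(a, b). a \<in> N \<and> b \<in> N \<and> a < b \<and> {a<..<b} \<inter> N = {}}"

definition refine_nodes :: "nat \<Rightarrow> real set \<Rightarrow> real set" where
  "refine_nodes m N = {a + real i / real m * (b - a) | a b i. (a, b) \<in> elements N \<and> i \<le> m}"

definition pw_const :: "real \<Rightarrow> real set \<Rightarrow> (real \<Rightarrow> real) set" where
  "pw_const T N =
     {f \<in> L2 T. \<forall>(a, b) \<in> elements N. \<exists>c. AE t in lebesgue_on {a<..<b}. f t = c}"

text \<open>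
  A mesh of the lateral boundary: the node sets of the decompositions at \<open>x = 0\<close> and \<open>x = L\<close>.
\<close>

type_synonym mesh = "real set \<times> real set"

definition is_mesh :: "real \<Rightarrow> mesh \<Rightarrow> bool" where
  "is_mesh T M \<longleftrightarrow> decomposition T (fst M) \<and> decomposition T (snd M)"

definition uniform_mesh :: "mesh \<Rightarrow> bool" where
  "uniform_mesh M \<longleftrightarrow> (\<exists>H. \<forall>(a, b) \<in> elements (fst M) \<union> elements (snd M). b - a = H)"

definition refine_mesh :: "nat \<Rightarrow> mesh \<Rightarrow> mesh" where
  "refine_mesh m M = (refine_nodes m (fst M), refine_nodes m (snd M))"

definition S0 :: "real \<Rightarrow> mesh \<Rightarrow> bfun set" where
  "S0 T M = pw_const T (fst M) \<times> pw_const T (snd M)"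


definition mixed_solution ::
    "real \<Rightarrow> real \<Rightarrow> mesh \<Rightarrow> mesh \<Rightarrow> bfun \<Rightarrow> bfun \<Rightarrow> bfun \<Rightarrow> bool" where
  "mixed_solution T L Mh MH g p\<^sub>h w\<^sub>H \<longleftrightarrow>
     p\<^sub>h \<in> S0 T Mh \<and> w\<^sub>H \<in> S0 T MH \<and>
     (\<forall>q \<in> S0 T Mh. inner_bd T p\<^sub>h q + inner_bd T (single_layer L w\<^sub>H) q = inner_bd T g q) \<and>
     (\<forall>v \<in> S0 T MH. inner_bd T p\<^sub>h (single_layer L v) = 0)"

end

theory Submission
  imports Defs
begin

text \<open>
  Let \<open>J\<close> denote componentwise integration from \<open>0\<close>. Integration by parts gives
  \<open>\<langle>u, v\<rangle> = - \<langle>J u, \<partial>\<^sub>t v\<rangle>\<close>, so the dual norm of \<open>u\<close> is at most the \<open>L\<^sup>2\<close> norm of \<open>J u\<close>, and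
  \<open>V u\<close> is half of \<open>J u\<close> plus a swapped shift of \<open>J u\<close> by \<open>L\<close>. On the \<open>n\<close> slabs of length \<open>L\<close> this
  is a bidiagonal matrix, whose smallest singular value is \<open>2 sin (\<pi> / (2 (2 n + 1)))\<close>.
  For discrete \<open>d\<close> the function \<open>V d\<close> is affine on every coarse element, so its projection \<open>Q V d\<close>
  to the fine space takes the values of \<open>V d\<close> at the midpoints, and
  \<open>\<parallel>Q V d\<parallel>\<^sup>2 \<ge> (1 - 1/m\<^sup>2) \<parallel>V d\<parallel>\<^sup>2\<close>. Testing the mixed formulation with \<open>Q V (v\<^sub>H - w\<^sub>H)\<close> bounds the norm
  of this function by that of \<open>g - V v\<^sub>H\<close>, hence by \<open>c\<^sub>2 \<parallel>w - v\<^sub>H\<parallel>\<close>, and the triangle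
  inequality finishes the proof.
\<close>

section \<open>Square-integrable functions\<close>

text \<open>The extended operator enters at one place only: \<open>c\<^sub>2\<close> is applied to
  the functional w - \<open>v\<^sub>H\<close>, at which V has the value g - V
  \<open>v\<^sub>H\<close>. All other estimates concern square-integrable functions, for which V and
  J are explicit integrals. The derivative in the \<open>H1_norm_bd\<close> is an arbitrary choice,
  known only through test functions. Integration by parts therefore rests on recovering v(s) = -
  \<integral> v' over (s, T) from the weak definition, and this needs concrete test functions. The
  nodes at the multiples of L make the shift by L carry elements to elements. Otherwise V d could
  have kinks inside an element, and midpoint values would no longer be means. In the final constant,
  the summand 1 is the distance from w to \<open>v\<^sub>H\<close> in the triangle inequality. The
  sine is the smallest singular value times the one half in V, and 2m/(m-2) is the reciprocal of a
  lower bound for the square root of 1 - 1/m^2.\<close>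

text \<open>Endpoints are null sets. The gauge integral over the closed interval is the side on
  which the fundamental theorem, translation and concatenation of intervals are applied
  later.\<close>

lemma LINT_eq_integral:
  fixes f :: "real \<Rightarrow> real"
  assumes "integrable (lebesgue_on {a<..<b}) f"
  shows "(LINT t|lebesgue_on {a<..<b}. f t) = integral {a..b} f" and "f integrable_on {a..b}"
proof -
  show "(LINT t|lebesgue_on {a<..<b}. f t) = integral {a..b} f"
    using lebesgue_integral_eq_integral[OF assms] by (simp add: integral_open_interval_real)
  have "f integrable_on {a<..<b}"
    using assms by (simp add: integrable_on_lebesgue_on)
  then show "f integrable_on {a..b}"
    by (simp add: integrable_on_open_interval_real)
qed

lemma integrable_lebesgue_on_mono:
  fixes f :: "real \<Rightarrow> real"
  assumes "integrable (lebesgue_on B) f" "A \<subseteq> B" "A \<in> sets lebesgue" "B \<in> sets lebesgue"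
  shows "integrable (lebesgue_on A) f"
  using assms set_integrable_subset[of lebesgue B f A]
  by (simp add: set_integrable_def integrable_restrict_space)

text \<open>Serves three step sizes: slabs of length L, coarse elements and fine elements.\<close>

lemma LINT_grid_split:
  fixes f :: "real \<Rightarrow> real"
  assumes "integrable (lebesgue_on {0<..<real N * h}) f" "h > 0"
  shows "(LINT t|lebesgue_on {0<..<real N * h}. f t) =
    (\<Sum>j<N. LINT t|lebesgue_on {real j * h<..<real (Suc j) * h}. f t)"
  using assms
proof (induction N)
  case 0
  then show ?case by (simp add: LINT_eq_integral)
next
  case (Suc N)
  have le: "0 \<le> real N * h" "real N * h \<le> real (Suc N) * h"
    using Suc.prems by (auto simp: mult_right_mono)
  have i1: "integrable (lebesgue_on {0<..<real N * h}) f"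
    and i2: "integrable (lebesgue_on {real N * h<..<real (Suc N) * h}) f"
    by (rule integrable_lebesgue_on_mono[OF Suc.prems(1)]; use le in auto)+
  have "integral {0..real N * h} f + integral {real N * h..real (Suc N) * h} f
      = integral {0..real (Suc N) * h} f"
    using le LINT_eq_integral(2)[OF Suc.prems(1)] Henstock_Kurzweil_Integration.integral_combine by blast
  then show ?case
    using Suc.IH[OF i1 Suc.prems(2)] LINT_eq_integral(1)[OF i1] LINT_eq_integral(1)[OF i2]
      LINT_eq_integral(1)[OF Suc.prems(1)] by simp
qed

lemma finite_measure_lebesgue_on_Ioo: "finite_measure (lebesgue_on {a<..<b::real})"
  by (intro finite_measureI, cases "a \<le> b") (simp_all add: emeasure_restrict_space)

lemma L2_D:
  assumes "f \<in> L2 T"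
  shows "f \<in> borel_measurable (lebesgue_on {0<..<T})"
    and "integrable (lebesgue_on {0<..<T}) (\<lambda>t. (f t)\<^sup>2)"
  using assms by (auto simp: L2_def)

lemma L2_mult_integrable:
  assumes "f \<in> L2 T" "g \<in> L2 T"
  shows "integrable (lebesgue_on {0<..<T}) (\<lambda>t. f t * g t)"
proof (rule Bochner_Integration.integrable_bound)
  show "integrable (lebesgue_on {0<..<T}) (\<lambda>t. (f t)\<^sup>2 + (g t)\<^sup>2)"
    using assms by (intro Bochner_Integration.integrable_add L2_D)
  show "(\<lambda>t. f t * g t) \<in> borel_measurable (lebesgue_on {0<..<T})"
    using assms by (intro borel_measurable_times L2_D)
  show "AE t in lebesgue_on {0<..<T}. norm (f t * g t) \<le> norm ((f t)\<^sup>2 + (g t)\<^sup>2)"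
  proof (rule AE_I2)
    fix t
    have "2 * (\<bar>f t\<bar> * \<bar>g t\<bar>) \<le> (f t)\<^sup>2 + (g t)\<^sup>2"
      using sum_squares_bound[of "\<bar>f t\<bar>" "\<bar>g t\<bar>"] by simp
    moreover have "0 \<le> \<bar>f t\<bar> * \<bar>g t\<bar>" by simp
    ultimately have "\<bar>f t\<bar> * \<bar>g t\<bar> \<le> (f t)\<^sup>2 + (g t)\<^sup>2" by linarith
    then show "norm (f t * g t) \<le> norm ((f t)\<^sup>2 + (g t)\<^sup>2)"
      by (simp add: abs_mult)
  qed
qed

lemma L2_const [simp]: "(\<lambda>t. c) \<in> L2 T"
  using finite_measure.integrable_const[OF finite_measure_lebesgue_on_Ioo]
  by (auto simp: L2_def)

lemma L2_integrable:
  assumes "f \<in> L2 T"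
  shows "integrable (lebesgue_on {0<..<T}) f"
  using L2_mult_integrable[OF assms L2_const[of 1]] by simp

lemma L2_lincomb:
  assumes "f \<in> L2 T" "g \<in> L2 T"
  shows "(\<lambda>t. a * f t + b * g t) \<in> L2 T"
proof -
  have "(\<lambda>t. (a * f t + b * g t)\<^sup>2) = (\<lambda>t. a * a * (f t)\<^sup>2 + 2 * a * b * (f t * g t) + b * b * (g t)\<^sup>2)"
    by (auto simp: power2_eq_square algebra_simps)
  then show ?thesis
    using assms L2_mult_integrable[OF assms] unfolding L2_def by auto
qed

lemma bounded_measurable_L2:
  assumes "f \<in> borel_measurable (lebesgue_on {0<..<T})" "\<And>t. t \<in> {0<..<T} \<Longrightarrow> \<bar>f t\<bar> \<le> B"
  shows "f \<in> L2 T"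
proof -
  have "integrable (lebesgue_on {0<..<T}) (\<lambda>t. (f t)\<^sup>2)"
  proof (rule finite_measure.integrable_const_bound[OF finite_measure_lebesgue_on_Ioo, where B = "B\<^sup>2"])
    show "AE t in lebesgue_on {0<..<T}. norm ((f t)\<^sup>2) \<le> B\<^sup>2"
    proof (rule AE_I2)
      fix t assume "t \<in> space (lebesgue_on {0<..<T})"
      then have "\<bar>f t\<bar> \<le> B" using assms by auto
      then show "norm ((f t)\<^sup>2) \<le> B\<^sup>2"
        using power_mono[of "\<bar>f t\<bar>" B 2] by simp
    qed
  qed (use assms in measurable)
  with assms show ?thesis by (simp add: L2_def)
qed

lemma continuous_on_L2:
  assumes "continuous_on {0..T} f"
  shows "f \<in> L2 T"
proof -
  have "compact (f ` {0..T})" using assms compact_continuous_image by blast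
  then obtain B where "\<And>t. t \<in> {0..T} \<Longrightarrow> \<bar>f t\<bar> \<le> B"
    using compact_imp_bounded bounded_real by (metis imageI)
  moreover have "f \<in> borel_measurable (lebesgue_on {0<..<T})"
    by (intro continuous_imp_measurable_on_sets_lebesgue continuous_on_subset[OF assms]) auto
  ultimately show ?thesis by (intro bounded_measurable_L2[of f T B]) auto
qed

section \<open>The inner product on pairs of boundary functions\<close>

lemma L2_bd_iff: "u \<in> L2_bd T \<longleftrightarrow> fst u \<in> L2 T \<and> snd u \<in> L2 T"
  by (cases u) (auto simp: L2_bd_def)

lemma lincomb_bd_simps [simp]:
  "fst (lincomb_bd a u b v) = (\<lambda>t. a * fst u t + b * fst v t)"
  "snd (lincomb_bd a u b v) = (\<lambda>t. a * snd u t + b * snd v t)"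
  by (auto simp: lincomb_bd_def)

lemma L2_bd_lincomb:
  "u \<in> L2_bd T \<Longrightarrow> v \<in> L2_bd T \<Longrightarrow> lincomb_bd a u b v \<in> L2_bd T"
  by (auto simp: L2_bd_iff L2_lincomb)

lemma LINT_mult_lincomb:
  assumes "f \<in> L2 T" "g \<in> L2 T" "k \<in> L2 T"
  shows "(LINT t|lebesgue_on {0<..<T}. k t * (a * f t + b * g t)) =
    a * (LINT t|lebesgue_on {0<..<T}. k t * f t) + b * (LINT t|lebesgue_on {0<..<T}. k t * g t)"
proof -
  have "(\<lambda>t. k t * (a * f t + b * g t)) = (\<lambda>t. a * (k t * f t) + b * (k t * g t))"
    by (auto simp: algebra_simps)
  then show ?thesis
    using assms by (simp add: L2_mult_integrable)
qed

lemma inner_bd_commute: "inner_bd T u v = inner_bd T v u"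
  by (simp add: inner_bd_def mult.commute)

lemma inner_bd_lincomb_right:
  assumes "u \<in> L2_bd T" "v \<in> L2_bd T" "z \<in> L2_bd T"
  shows "inner_bd T z (lincomb_bd a u b v) = a * inner_bd T z u + b * inner_bd T z v"
  using assms unfolding inner_bd_def L2_bd_iff lincomb_bd_simps
  by (simp add: LINT_mult_lincomb) (simp add: algebra_simps)

lemma inner_bd_lincomb_left:
  assumes "u \<in> L2_bd T" "v \<in> L2_bd T" "z \<in> L2_bd T"
  shows "inner_bd T (lincomb_bd a u b v) z = a * inner_bd T u z + b * inner_bd T v z"
  using inner_bd_lincomb_right[OF assms] inner_bd_commute by metis

lemma inner_bd_nonneg: "0 \<le> inner_bd T u u"
  by (auto simp: inner_bd_def intro!: add_nonneg_nonneg Bochner_Integration.integral_nonneg)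

lemma norm_bd_nonneg: "0 \<le> norm_bd T u"
  by (simp add: norm_bd_def inner_bd_nonneg)

lemma norm_bd_square: "(norm_bd T u)\<^sup>2 = inner_bd T u u"
  by (simp add: norm_bd_def inner_bd_nonneg)

text \<open>On representatives \<open>inner_bd\<close> is only semidefinite, so \<open>C = 0\<close>
  does not make v the zero function. That case is settled by the quadratic form: if \<open>B\<close>
  were nonzero, a suitable multiple of v would give it the value -1.\<close>

lemma inner_bd_Cauchy_Schwarz:
  assumes u: "u \<in> L2_bd T" and v: "v \<in> L2_bd T"
  shows "\<bar>inner_bd T u v\<bar> \<le> norm_bd T u * norm_bd T v"
proof -
  define A B C where "A = inner_bd T u u" and "B = inner_bd T u v" and "C = inner_bd T v v"
  have AC: "0 \<le> A" "0 \<le> C" by (auto simp: A_def C_def inner_bd_nonneg)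
  have q: "0 \<le> x * x * A + 2 * x * y * B + y * y * C" for x y
  proof -
    have "inner_bd T (lincomb_bd x u y v) (lincomb_bd x u y v) = x * x * A + 2 * x * y * B + y * y * C"
      using u v by (simp add: inner_bd_lincomb_left inner_bd_lincomb_right L2_bd_lincomb
          A_def B_def C_def inner_bd_commute[of T v u] algebra_simps)
    then show ?thesis using inner_bd_nonneg[of T "lincomb_bd x u y v"] by simp
  qed
  have "B\<^sup>2 \<le> A * C"
  proof (cases "C = 0")
    case True
    have "B = 0"
    proof (rule ccontr)
      assume "B \<noteq> 0"
      then have "1 * 1 * A + 2 * 1 * (- (A + 1) / (2 * B)) * B = - 1" by (simp add: field_simps)
      then show False using q[of 1 "- (A + 1) / (2 * B)"] True by simp
    qed
    then show ?thesis using AC by simp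
  next
    case False
    \<comment> \<open>Up to scaling, (C, -B) minimises the form among the pairs with the same first
      coefficient.\<close>
    have "C * C * A + 2 * C * (- B) * B + (- B) * (- B) * C = C * (A * C - B\<^sup>2)"
      by (simp add: power2_eq_square algebra_simps)
    then have "0 \<le> C * (A * C - B\<^sup>2)" using q[of C "- B"] by simp
    then show ?thesis using False AC by (simp add: zero_le_mult_iff)
  qed
  then have "B\<^sup>2 \<le> (norm_bd T u * norm_bd T v)\<^sup>2"
    by (simp add: power_mult_distrib norm_bd_square A_def C_def)
  then show ?thesis
    unfolding B_def using abs_le_square_iff[of "inner_bd T u v" "norm_bd T u * norm_bd T v"]
    by (simp add: norm_bd_nonneg)
qed

section \<open>Weak derivatives\<close>

text \<open>Test functions in \<open>weak_deriv\<close> need only be C^1, so quadratic splines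
  suffice. A second difference of truncated powers gives \<open>step1\<close>, which rises from 0 to
  1 on [0, 1]; its derivative \<open>tent\<close> is a hat of mass one.\<close>

definition ramp2 :: "real \<Rightarrow> real" where "ramp2 x = (max 0 x)\<^sup>2"

definition step1 :: "real \<Rightarrow> real" where
  "step1 x = 2 * (ramp2 x - 2 * ramp2 (x - 1/2) + ramp2 (x - 1))"

definition tent :: "real \<Rightarrow> real" where
  "tent x = 4 * (max 0 x - 2 * max 0 (x - 1/2) + max 0 (x - 1))"

lemma ramp2_deriv: "(ramp2 has_real_derivative 2 * max 0 x) (at x)"
proof -
  consider "x > 0" | "x < 0" | "x = 0" by linarith
  then show ?thesis
  proof cases
    case 1
    have "((\<lambda>x. x\<^sup>2) has_real_derivative 2 * x) (at x)"
      by (auto intro!: derivative_eq_intros)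
    moreover have "\<forall>\<^sub>F y in nhds x. y > 0" using 1 by (rule eventually_nhds_in_open[OF open_greaterThan, of x 0, simplified])
    then have "\<forall>\<^sub>F y in nhds x. ramp2 y = y\<^sup>2"
      by eventually_elim (auto simp: ramp2_def)
    ultimately show ?thesis using 1 DERIV_cong_ev[of x x ramp2 "\<lambda>x. x\<^sup>2" "2 * x" "2 * x"] by simp
  next
    case 2
    have "\<forall>\<^sub>F y in nhds x. y < 0" using 2 by (rule eventually_nhds_in_open[OF open_lessThan, of x 0, simplified])
    then have "\<forall>\<^sub>F y in nhds x. ramp2 y = 0"
      by eventually_elim (auto simp: ramp2_def)
    then show ?thesis using 2 DERIV_cong_ev[of x x ramp2 "\<lambda>x. 0" 0 0] by simp
  next
    case 3
    have "((\<lambda>h. ramp2 h / h) \<longlongrightarrow> 0) (at 0)"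
    proof (rule Lim_null_comparison)
      show "\<forall>\<^sub>F h in at 0. norm (ramp2 h / h) \<le> \<bar>h\<bar>"
        by (intro always_eventually allI) (auto simp: ramp2_def max_def power2_eq_square)
      show "((\<lambda>h::real. \<bar>h\<bar>) \<longlongrightarrow> 0) (at 0)"
        by (auto intro!: tendsto_eq_intros)
    qed
    then show ?thesis using 3 by (simp add: has_field_derivative_iff ramp2_def)
  qed
qed

lemma step1_deriv: "(step1 has_real_derivative tent x) (at x)"
  unfolding step1_def tent_def
  by (auto intro!: derivative_eq_intros DERIV_chain2[OF ramp2_deriv] simp: algebra_simps)

lemma step1_simps: "x \<le> 0 \<Longrightarrow> step1 x = 0" "x \<ge> 1 \<Longrightarrow> step1 x = 1"
  by (auto simp: step1_def ramp2_def max_def power2_eq_square algebra_simps)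

lemma tent_nonneg: "0 \<le> tent x"
  by (auto simp: tent_def max_def)

lemma tent_eq_zero: "x \<le> 0 \<or> x \<ge> 1 \<Longrightarrow> tent x = 0"
  by (auto simp: tent_def max_def)

lemma continuous_on_tent [continuous_intros]:
  "continuous_on S f \<Longrightarrow> continuous_on S (\<lambda>x. tent (f x))"
  unfolding tent_def by (intro continuous_intros)

lemma step1_mono: "x \<le> y \<Longrightarrow> step1 x \<le> step1 y"
  using DERIV_nonneg_imp_nondecreasing[of x y step1] step1_deriv tent_nonneg by blast

lemma step1_bounds: "0 \<le> step1 x" "step1 x \<le> 1"
  using step1_mono[of "min 0 x" x] step1_mono[of x "max 1 x"] by (auto simp: step1_simps)

lemma step1_scaled_deriv:
  "((\<lambda>x. step1 ((x - s) * c)) has_real_derivative tent ((x - s) * c) * c) (at x)"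
  by (rule DERIV_chain2[OF step1_deriv]) (auto intro!: derivative_eq_intros)

text \<open>\<open>step1\<close> is the antiderivative and climbs from 0 to 1 across [s, s + 1/c].
  The bump lies to the right of s, so its whole mass is inside when s + 1/c \<le> T.\<close>

lemma integral_tent:
  assumes "0 < s" "c > 0" "s + 1 / c \<le> T"
  shows "((\<lambda>x. tent ((x - s) * c) * c) has_integral 1) {0..T}"
proof -
  have "0 \<le> 1 / c" using assms by simp
  then have "0 \<le> T" using assms by linarith
  have "((\<lambda>x. tent ((x - s) * c) * c) has_integral step1 ((T - s) * c) - step1 ((0 - s) * c)) {0..T}"
    by (intro fundamental_theorem_of_calculus \<open>0 \<le> T\<close>)
      (metis step1_scaled_deriv has_real_derivative_iff_has_vector_derivative has_vector_derivative_at_within)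
  moreover have "(T - s) * c \<ge> 1" using assms by (simp add: field_simps)
  moreover have "(0 - s) * c \<le> 0" using assms by (simp add: mult_le_0_iff)
  ultimately show ?thesis by (simp add: step1_simps)
qed

lemma tent_approximate_identity:
  fixes v :: "real \<Rightarrow> real"
  assumes v: "continuous_on {0..T} v" and s: "0 < s" "s < T"
  shows "(\<lambda>n. integral {0..T} (\<lambda>x. v x * (tent ((x - s) * real n) * real n))) \<longlonglongrightarrow> v s"
proof (rule LIMSEQ_I)
  fix e :: real assume "e > 0"
  then have "e / 2 > 0" by simp
  then obtain d where d: "d > 0" "\<And>x. x \<in> {0..T} \<Longrightarrow> dist x s < d \<Longrightarrow> dist (v x) (v s) < e / 2"
    using v s unfolding continuous_on_iff by (metis atLeastAtMost_iff less_eq_real_def)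
  \<comment> \<open>Two demands on 1/n at once: the bump on [s, s + 1/n] must stay where v is close
    to v(s), and it must end before T.\<close>
  obtain N :: nat where N: "1 / min d (T - s) < real N"
    using reals_Archimedean2 by blast
  show "\<exists>no. \<forall>n\<ge>no. norm (integral {0..T} (\<lambda>x. v x * (tent ((x - s) * real n) * real n)) - v s) < e"
  proof (intro exI allI impI)
    fix n assume "n \<ge> N"
    define \<delta> where "\<delta> = min d (T - s)"
    have "0 < \<delta>" using d s by (simp add: \<delta>_def)
    then have "0 < 1 / \<delta>" by simp
    then have n0: "0 < real n" "1 / \<delta> < real n" using N \<open>n \<ge> N\<close> unfolding \<delta>_def by linarith+
    then have "1 / real n < \<delta>"
      using \<open>0 < \<delta>\<close> by (simp add: field_simps)
    then have n: "1 / real n < min d (T - s)" by (simp add: \<delta>_def)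
    define k where "k = (\<lambda>x. tent ((x - s) * real n) * real n)"
    have k: "(k has_integral 1) {0..T}"
      unfolding k_def using n n0 s by (intro integral_tent) auto
    have kc: "continuous_on {0..T} k" unfolding k_def by (intro continuous_intros)
    have vk: "((\<lambda>x. v x * k x) has_integral integral {0..T} (\<lambda>x. v x * k x)) {0..T}"
      by (intro integrable_integral integrable_continuous_interval continuous_intros v kc)
    have "((\<lambda>x. v x * k x - v s * k x) has_integral (integral {0..T} (\<lambda>x. v x * k x) - v s * 1)) {0..T}"
      by (intro has_integral_diff vk has_integral_mult_right k)
    then have D: "integral {0..T} (\<lambda>x. v x * k x - v s * k x) = integral {0..T} (\<lambda>x. v x * k x) - v s"
      by (simp add: integral_unique)
    have "norm (integral {0..T} (\<lambda>x. v x * k x - v s * k x)) \<le> integral {0..T} (\<lambda>x. e / 2 * k x)"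
    proof (rule integral_norm_bound_integral)
      show "(\<lambda>x. v x * k x - v s * k x) integrable_on {0..T}"
        by (intro integrable_continuous_interval continuous_intros v kc)
      show "(\<lambda>x. e / 2 * k x) integrable_on {0..T}"
        by (intro integrable_continuous_interval continuous_intros kc)
      fix x assume x: "x \<in> {0..T}"
      have k0: "0 \<le> k x" by (simp add: k_def tent_nonneg)
      show "norm (v x * k x - v s * k x) \<le> e / 2 * k x"
      proof (cases "s < x \<and> x < s + 1 / real n")
        case True
        then have "dist x s < d" using n by (auto simp: dist_real_def)
        then have "\<bar>v x - v s\<bar> \<le> e / 2" using d(2)[OF x] by (simp add: dist_real_def)
        then have "\<bar>v x - v s\<bar> * k x \<le> e / 2 * k x" using k0 by (rule mult_right_mono)
        moreover have "norm (v x * k x - v s * k x) = \<bar>v x - v s\<bar> * k x"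
          using k0 by (simp flip: left_diff_distrib add: abs_mult)
        ultimately show ?thesis by simp
      next
        case False
        then have "(x - s) * real n \<le> 0 \<or> (x - s) * real n \<ge> 1"
          using n0 by (auto simp: mult_le_0_iff field_simps)
        then show ?thesis by (simp add: k_def tent_eq_zero)
      qed
    qed
    also have "integral {0..T} (\<lambda>x. e / 2 * k x) = e / 2"
      using integral_unique[OF k] by simp
    finally show "norm (integral {0..T} (\<lambda>x. v x * (tent ((x - s) * real n) * real n)) - v s) < e"
      using D \<open>e > 0\<close> by (simp add: k_def)
  qed
qed

lemma step1_scaled_tendsto: "(\<lambda>n. step1 ((x - s) * real n)) \<longlonglongrightarrow> indicator {s<..} x"
proof (cases "s < x")
  case True
  obtain N :: nat where N: "1 / (x - s) < real N" using reals_Archimedean2 by blast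
  have "\<forall>n\<ge>N. step1 ((x - s) * real n) = 1"
  proof (intro allI impI)
    fix n assume "n \<ge> N"
    then have "1 / (x - s) < real n" using N by simp
    then show "step1 ((x - s) * real n) = 1"
      using True by (intro step1_simps) (simp add: field_simps)
  qed
  then have "\<forall>\<^sub>F n in sequentially. step1 ((x - s) * real n) = 1"
    unfolding eventually_sequentially by blast
  with True show ?thesis by (simp add: tendsto_eventually)
next
  case False
  then have "step1 ((x - s) * real n) = 0" for n
    by (intro step1_simps) (simp add: mult_le_0_iff)
  with False show ?thesis by simp
qed

lemma borel_measurable_indicator_lebesgue_on: "A \<in> sets borel \<Longrightarrow> indicator A \<in> borel_measurable (lebesgue_on B)"
  for A B :: "real set"
  by (intro measurable_restrict_space1 borel_measurable_indicator) auto

text \<open>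
  The test functions are \<open>C\<^sup>1\<close> approximations of the indicator of \<open>(s, t]\<close>, whose derivatives are
  approximate identities at \<open>s\<close> and at \<open>t\<close>.
\<close>

lemma weak_deriv_increment:
  assumes v: "continuous_on {0..T} v" and v': "v' \<in> L2 T" and wd: "weak_deriv T v v'"
    and st: "0 < s" "s < t" "t < T"
  shows "v t - v s = (LINT x|lebesgue_on {0<..<T}. v' x * (indicator {s<..} x - indicator {t<..} x))"
proof -
  define \<phi> where "\<phi> n x = step1 ((x - s) * real n) - step1 ((x - t) * real n)" for n x
  define \<phi>' where "\<phi>' n x = tent ((x - s) * real n) * real n - tent ((x - t) * real n) * real n" for n x
  have dphi: "((\<phi> n) has_real_derivative \<phi>' n x) (at x)" for n x
    unfolding \<phi>_def \<phi>'_def by (intro DERIV_diff step1_scaled_deriv)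
  have cphi': "continuous_on S (\<phi>' n)" for n S
    unfolding \<phi>'_def by (intro continuous_intros)
  have cphi: "continuous_on S (\<phi> n)" for n S
    using dphi DERIV_isCont continuous_at_imp_continuous_on by blast
  \<comment> \<open>The support [s, t + 1/n] of \<open>\<phi> n\<close> is inside (0, T) only for
    large n, so the defining equation is available eventually.\<close>
  have eq: "(LINT x|lebesgue_on {0<..<T}. v x * \<phi>' n x) = - (LINT x|lebesgue_on {0<..<T}. v' x * \<phi> n x)"
    if n: "real n > 1 / (T - t)" for n
  proof -
    have "0 < 1 / (T - t)" using st by simp
    then have n0: "0 < real n" using n by linarith
    then have nT: "1 / real n < T - t" using n st by (simp add: field_simps)
    have supp: "\<phi> n x = 0" if "x \<notin> {s..t + 1 / real n}" for x
    proof (cases "x < s")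
      case True
      with st have "(x - s) * real n \<le> 0" "(x - t) * real n \<le> 0" by (auto simp: mult_le_0_iff)
      then show ?thesis by (simp add: \<phi>_def step1_simps)
    next
      case False
      with that have "x > t + 1 / real n" by auto
      then have "(x - t) * real n \<ge> 1" using n0 by (simp add: field_simps)
      moreover have "(x - s) * real n \<ge> (x - t) * real n"
        using st by (intro mult_right_mono) auto
      ultimately show ?thesis by (simp add: \<phi>_def step1_simps)
    qed
    have "\<exists>a b. 0 < a \<and> b < T \<and> (\<forall>t. t \<notin> {a..b} \<longrightarrow> \<phi> n t = 0)"
      using supp st nT by (intro exI[of _ s] exI[of _ "t + 1 / real n"]) auto
    then show ?thesis using wd dphi cphi' unfolding weak_deriv_def by blast
  qed
  have ev: "\<forall>\<^sub>F n in sequentially. real n > 1 / (T - t)"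
    using filterlim_real_sequentially by (simp add: filterlim_at_top_dense)
  have "integral {0..T} (\<lambda>x. v x * \<phi>' n x) =
      integral {0..T} (\<lambda>x. v x * (tent ((x - s) * real n) * real n)) -
      integral {0..T} (\<lambda>x. v x * (tent ((x - t) * real n) * real n))" for n
    unfolding \<phi>'_def right_diff_distrib
    by (intro Henstock_Kurzweil_Integration.integral_diff integrable_continuous_interval continuous_intros v)
  moreover have "(LINT x|lebesgue_on {0<..<T}. v x * \<phi>' n x) = integral {0..T} (\<lambda>x. v x * \<phi>' n x)" for n
    by (intro LINT_eq_integral L2_integrable continuous_on_L2 continuous_intros v cphi')
  ultimately have l1: "(\<lambda>n. LINT x|lebesgue_on {0<..<T}. v x * \<phi>' n x) \<longlonglongrightarrow> v s - v t"
    using tendsto_diff[OF tent_approximate_identity[OF v, of s] tent_approximate_identity[OF v, of t]] st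
    by simp
  have l2: "(\<lambda>n. LINT x|lebesgue_on {0<..<T}. v' x * \<phi> n x) \<longlonglongrightarrow>
     (LINT x|lebesgue_on {0<..<T}. v' x * (indicator {s<..} x - indicator {t<..} x))"
  proof (rule integral_dominated_convergence[where w = "\<lambda>x. \<bar>v' x\<bar>"])
    show "(\<lambda>x. v' x * (indicator {s<..} x - indicator {t<..} x)) \<in> borel_measurable (lebesgue_on {0<..<T})"
      by (intro borel_measurable_times borel_measurable_diff borel_measurable_indicator_lebesgue_on L2_D(1)[OF v']) auto
    show "(\<lambda>x. v' x * \<phi> n x) \<in> borel_measurable (lebesgue_on {0<..<T})" for n
      by (intro borel_measurable_times L2_D(1)[OF v'] L2_D(1)[OF continuous_on_L2[OF cphi]])
    show "integrable (lebesgue_on {0<..<T}) (\<lambda>x. \<bar>v' x\<bar>)"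
      using L2_integrable[OF v'] by (rule integrable_abs)
    show "AE x in lebesgue_on {0<..<T}. (\<lambda>n. v' x * \<phi> n x) \<longlonglongrightarrow> v' x * (indicator {s<..} x - indicator {t<..} x)"
      unfolding \<phi>_def by (intro AE_I2 tendsto_intros step1_scaled_tendsto)
    show "AE x in lebesgue_on {0<..<T}. norm (v' x * \<phi> n x) \<le> \<bar>v' x\<bar>" for n
    proof (rule AE_I2)
      fix x
      have "\<bar>\<phi> n x\<bar> \<le> 1"
        using step1_bounds[of "(x - s) * real n"] step1_bounds[of "(x - t) * real n"]
        unfolding \<phi>_def by linarith
      then show "norm (v' x * \<phi> n x) \<le> \<bar>v' x\<bar>"
        by (simp add: abs_mult mult_left_le)
    qed
  qed
  have "(\<lambda>n. LINT x|lebesgue_on {0<..<T}. v x * \<phi>' n x) \<longlonglongrightarrow>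
     - (LINT x|lebesgue_on {0<..<T}. v' x * (indicator {s<..} x - indicator {t<..} x))"
    using tendsto_minus[OF l2] by (rule Lim_transform_eventually)
      (use ev in eventually_elim, simp add: eq)
  with l1 have "v s - v t = - (LINT x|lebesgue_on {0<..<T}. v' x * (indicator {s<..} x - indicator {t<..} x))"
    using LIMSEQ_unique by blast
  then show ?thesis by simp
qed

text \<open>The increment formula needs two interior points. The end T is reached as a limit from
  below, where continuity of v up to T gives v(T) = 0 its meaning.\<close>

lemma weak_deriv_end0:
  assumes v: "continuous_on {0..T} v" "v T = 0" and v': "v' \<in> L2 T" and wd: "weak_deriv T v v'"
    and s: "0 < s" "s < T"
  shows "v s = - (LINT x|lebesgue_on {0<..<T}. v' x * indicator {s<..} x)"
proof -
  \<comment> \<open>With + 1 in place of + 2 the first point would be s itself.\<close>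
  define \<tau> where "\<tau> n = T - (T - s) / (real n + 2)" for n
  have \<tau>: "s < \<tau> n" "\<tau> n < T" for n
  proof -
    have "(T - s) / (real n + 2) < (T - s) / 1" using s by (intro divide_strict_left_mono) auto
    then show "s < \<tau> n" by (simp add: \<tau>_def)
    show "\<tau> n < T" using s by (simp add: \<tau>_def)
  qed
  have "(\<lambda>n. (T - s) / (real n + 2)) \<longlonglongrightarrow> 0"
    using LIMSEQ_ignore_initial_segment[OF lim_const_over_n[of "T - s"], of 2] by (simp add: add.commute)
  then have \<tau>T: "\<tau> \<longlonglongrightarrow> T"
    unfolding \<tau>_def using tendsto_diff[OF tendsto_const[of T]] by fastforce
  have "(\<lambda>n. v (\<tau> n)) \<longlonglongrightarrow> v T"
    using v(1) \<tau>T \<tau> s by (intro continuous_on_tendsto_compose[OF v(1) \<tau>T])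
      (auto intro!: always_eventually less_imp_le intro: less_trans)
  then have l1: "(\<lambda>n. v (\<tau> n) - v s) \<longlonglongrightarrow> - v s"
    using v by (auto intro!: tendsto_eq_intros)
  have l2: "(\<lambda>n. LINT x|lebesgue_on {0<..<T}. v' x * (indicator {s<..} x - indicator {\<tau> n<..} x)) \<longlonglongrightarrow>
     (LINT x|lebesgue_on {0<..<T}. v' x * indicator {s<..} x)"
  proof (rule integral_dominated_convergence[where w = "\<lambda>x. \<bar>v' x\<bar>"])
    show "(\<lambda>x. v' x * indicator {s<..} x) \<in> borel_measurable (lebesgue_on {0<..<T})"
      by (intro borel_measurable_times borel_measurable_indicator_lebesgue_on L2_D(1)[OF v']) auto
    show "(\<lambda>x. v' x * (indicator {s<..} x - indicator {\<tau> n<..} x)) \<in> borel_measurable (lebesgue_on {0<..<T})" for n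
      by (intro borel_measurable_times borel_measurable_diff borel_measurable_indicator_lebesgue_on L2_D(1)[OF v']) auto
    show "integrable (lebesgue_on {0<..<T}) (\<lambda>x. \<bar>v' x\<bar>)"
      using L2_integrable[OF v'] by (rule integrable_abs)
    show "AE x in lebesgue_on {0<..<T}. (\<lambda>n. v' x * (indicator {s<..} x - indicator {\<tau> n<..} x))
        \<longlonglongrightarrow> v' x * indicator {s<..} x"
    proof (rule AE_I2)
      fix x assume "x \<in> space (lebesgue_on {0<..<T})"
      then have "x < T" by auto
      then have "\<forall>\<^sub>F n in sequentially. x < \<tau> n" using order_tendstoD(1)[OF \<tau>T] by blast
      then have "\<forall>\<^sub>F n in sequentially. v' x * (indicator {s<..} x - indicator {\<tau> n<..} x) = v' x * indicator {s<..} x"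
        by eventually_elim auto
      then show "(\<lambda>n. v' x * (indicator {s<..} x - indicator {\<tau> n<..} x)) \<longlonglongrightarrow> v' x * indicator {s<..} x"
        by (rule tendsto_eventually)
    qed
    show "AE x in lebesgue_on {0<..<T}. norm (v' x * (indicator {s<..} x - indicator {\<tau> n<..} x)) \<le> \<bar>v' x\<bar>" for n
      by (rule AE_I2) (auto simp: indicator_def)
  qed
  have "v (\<tau> n) - v s = (LINT x|lebesgue_on {0<..<T}. v' x * (indicator {s<..} x - indicator {\<tau> n<..} x))" for n
    using weak_deriv_increment[OF v(1) v' wd s(1) \<tau>(1) \<tau>(2)] .
  with l1 l2 show ?thesis using LIMSEQ_unique by fastforce
qed

section \<open>The primitive and the dual norm\<close>

lemma integral_0_restrict:
  assumes "x \<in> {0<..<T}"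
  shows "integral_0 u x = (LINT s|lebesgue_on {0<..<T}. u s * indicator {..<x} s)"
proof -
  have "(\<lambda>s. indicator {0<..<x} s * u s) = (\<lambda>s. indicator {0<..<T} s * (u s * indicator {..<x} s))"
    using assms by (auto simp: indicator_def)
  then show ?thesis
    by (simp add: integral_0_def integral_restrict_space)
qed

text \<open>Fubini on the triangle s < x. With w a weak derivative this replaces a product rule in
  the integration by parts.\<close>

lemma LINT_triangle_swap:
  fixes u w :: "real \<Rightarrow> real"
  assumes u: "integrable (lebesgue_on {0<..<T}) u" and w: "integrable (lebesgue_on {0<..<T}) w"
  shows "(LINT s|lebesgue_on {0<..<T}. u s * (LINT x|lebesgue_on {0<..<T}. w x * indicator {s<..} x)) =
    (LINT x|lebesgue_on {0<..<T}. w x * integral_0 u x)"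
proof -
  define M where "M = lebesgue_on {0<..<T}"
  interpret finite_measure M unfolding M_def by (rule finite_measure_lebesgue_on_Ioo)
  interpret P: pair_sigma_finite M M by unfold_locales
  have [measurable]: "u \<in> borel_measurable M" "w \<in> borel_measurable M"
    using u w by (auto simp: M_def)
  have idm [measurable]: "(\<lambda>x. x) \<in> borel_measurable M"
    unfolding M_def by (intro measurable_restrict_space1 measurable_completion) auto
  define F where "F s x = u s * (w x * indicator {s<..} x)" for s x
  \<comment> \<open>As a conditional on s < x, the kernel is seen to be measurable jointly in both
    variables.\<close>
  have ind: "indicator {s<..} x = (if s < x then 1 else 0 :: real)" for s x :: real
    by auto
  have Fm [measurable]: "case_prod F \<in> borel_measurable (M \<Otimes>\<^sub>M M)"
    unfolding F_def ind by measurable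
  have wi: "integrable M (\<lambda>x. w x * indicator {s<..} x)" for s
  proof (rule Bochner_Integration.integrable_bound)
    show "integrable M w" using w by (simp add: M_def)
    show "(\<lambda>x. w x * indicator {s<..} x) \<in> borel_measurable M" unfolding ind by measurable
  qed (auto simp: indicator_def)
  have "integrable (M \<Otimes>\<^sub>M M) (case_prod F)"
  proof (rule P.Fubini_integrable[OF Fm])
    show "AE x in M. integrable M (\<lambda>y. case_prod F (x, y))"
      unfolding F_def by (intro AE_I2) (simp add: wi)
    show "integrable M (\<lambda>x. LINT y|M. norm (case_prod F (x, y)))"
    proof (rule Bochner_Integration.integrable_bound)
      \<comment> \<open>Dropping the indicator leaves a product of two integrable functions as the
        majorant.\<close>
      show "integrable M (\<lambda>s. \<bar>u s\<bar> * (LINT x|M. \<bar>w x\<bar>))"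
        using u by (simp add: M_def)
      show "(\<lambda>x. LINT y|M. norm (case_prod F (x, y))) \<in> borel_measurable M"
        by measurable
      show "AE s in M. norm (LINT y|M. norm (case_prod F (s, y))) \<le> norm (\<bar>u s\<bar> * (LINT x|M. \<bar>w x\<bar>))"
      proof (rule AE_I2)
        fix s
        have "integrable M (\<lambda>x. norm (F s x))"
          unfolding F_def by (intro integrable_norm integrable_mult_right wi)
        moreover have "integrable M (\<lambda>x. \<bar>u s\<bar> * \<bar>w x\<bar>)"
          using w by (simp add: M_def)
        ultimately have "(LINT x|M. norm (F s x)) \<le> (LINT x|M. \<bar>u s\<bar> * \<bar>w x\<bar>)"
          by (rule integral_mono) (simp add: F_def abs_mult indicator_def)
        then show "norm (LINT y|M. norm (case_prod F (s, y))) \<le> norm (\<bar>u s\<bar> * (LINT x|M. \<bar>w x\<bar>))"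
          by simp
      qed
    qed
  qed
  then have "(LINT x|M. LINT s|M. F s x) = (LINT s|M. LINT x|M. F s x)"
    by (rule P.Fubini_integral)
  moreover have inner: "(LINT s|M. F s x) = w x * integral_0 u x" if "x \<in> space M" for x
  proof -
    have "F s x = w x * (u s * indicator {..<x} s)" for s
      by (auto simp: F_def indicator_def)
    then show ?thesis using that integral_0_restrict[of x T u] by (simp add: M_def)
  qed
  moreover have "(LINT x|M. F s x) = u s * (LINT x|M. w x * indicator {s<..} x)" for s
    by (simp add: F_def)
  moreover have "(LINT x|M. LINT s|M. F s x) = (LINT x|M. w x * integral_0 u x)"
    by (intro Bochner_Integration.integral_cong refl inner)
  ultimately show ?thesis
    by (simp add: M_def)
qed

section \<open>Integration by parts against functions vanishing at T\<close>

lemma H1_end0_L2: "v \<in> H1_end0 T \<Longrightarrow> v \<in> L2 T"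
  by (simp add: H1_end0_def)

lemma dt_props:
  assumes "v \<in> H1_end0 T"
  shows "dt T v \<in> L2 T" "weak_deriv T v (dt T v)"
proof -
  have "\<exists>q'. q' \<in> L2 T \<and> weak_deriv T v q'" using assms by (auto simp: H1_end0_def)
  from someI_ex[OF this] have "dt T v \<in> L2 T \<and> weak_deriv T v (dt T v)"
    unfolding dt_def .
  then show "dt T v \<in> L2 T" "weak_deriv T v (dt T v)"
    by simp_all
qed

text \<open>No boundary terms appear, since the primitive vanishes at 0 and v at T. Replacing v by
  the integral of its derivative over (s, T) leaves exactly the triangle swap.\<close>

lemma integration_by_parts_H1_end0:
  assumes u: "u \<in> L2 T" and v: "v \<in> H1_end0 T"
  shows "(LINT t|lebesgue_on {0<..<T}. u t * v t) = - (LINT t|lebesgue_on {0<..<T}. integral_0 u t * dt T v t)"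
proof -
  have "v s = - (LINT x|lebesgue_on {0<..<T}. dt T v x * indicator {s<..} x)" if "s \<in> {0<..<T}" for s
    using weak_deriv_end0[of T v "dt T v" s] dt_props[OF v] v that by (auto simp: H1_end0_def)
  then have "(LINT t|lebesgue_on {0<..<T}. u t * v t) =
     (LINT s|lebesgue_on {0<..<T}. - (u s * (LINT x|lebesgue_on {0<..<T}. dt T v x * indicator {s<..} x)))"
    by (intro Bochner_Integration.integral_cong) auto
  also have "\<dots> = - (LINT s|lebesgue_on {0<..<T}. u s * (LINT x|lebesgue_on {0<..<T}. dt T v x * indicator {s<..} x))"
    by simp
  also have "\<dots> = - (LINT x|lebesgue_on {0<..<T}. dt T v x * integral_0 u x)"
    using u dt_props[OF v] by (simp add: LINT_triangle_swap L2_integrable)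
  finally show ?thesis by (simp add: mult.commute)
qed

lemma integral_0_eq_integral:
  assumes "u \<in> L2 T" "t \<le> T"
  shows "integral_0 u t = integral {0..t} u"
  unfolding integral_0_def using assms
  by (intro LINT_eq_integral integrable_lebesgue_on_mono[OF L2_integrable[OF assms(1)]]) auto

lemma integral_0_nonpos: "t \<le> 0 \<Longrightarrow> integral_0 u t = 0"
  by (simp add: integral_0_def integral_restrict_space)

text \<open>Negative times are included because V evaluates the primitive at t - L; there it is
  constantly 0.\<close>

lemma continuous_on_integral_0:
  assumes "u \<in> L2 T"
  shows "continuous_on {..T} (integral_0 u)"
proof (cases "0 \<le> T")
  case True
  have "continuous_on {0..T} (\<lambda>t. integral {0..t} u)"
    using LINT_eq_integral(2)[OF L2_integrable[OF assms]] by (rule indefinite_integral_continuous_1)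
  then have 1: "continuous_on {0..T} (integral_0 u)"
    by (rule continuous_on_eq) (simp add: integral_0_eq_integral[OF assms])
  have 2: "continuous_on {..0} (integral_0 u)"
    by (rule continuous_on_eq[of _ "\<lambda>t. 0"]) (auto simp: integral_0_nonpos)
  have "continuous_on ({..0} \<union> {0..T}) (integral_0 u)"
    by (rule continuous_on_closed_Un[OF closed_atMost closed_atLeastAtMost 2 1])
  then show ?thesis by (rule continuous_on_subset) auto
next
  case False
  have "continuous_on {..T} (\<lambda>t. 0 :: real)" by simp
  then show ?thesis by (rule continuous_on_eq) (use False in \<open>auto simp: integral_0_nonpos\<close>)
qed

definition primitive_bd :: "bfun \<Rightarrow> bfun" where
  "primitive_bd u = (integral_0 (fst u), integral_0 (snd u))"

lemma integral_0_L2: "u \<in> L2 T \<Longrightarrow> integral_0 u \<in> L2 T"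
  by (rule continuous_on_L2, rule continuous_on_subset[OF continuous_on_integral_0]) auto

lemma primitive_bd_L2: "u \<in> L2_bd T \<Longrightarrow> primitive_bd u \<in> L2_bd T"
  by (auto simp: L2_bd_iff primitive_bd_def integral_0_L2)

lemma H1_bd_L2: "v \<in> H1_bd T \<Longrightarrow> v \<in> L2_bd T"
  by (auto simp: H1_bd_def L2_bd_iff H1_end0_L2)

lemma inner_bd_H1_bound:
  assumes u: "u \<in> L2_bd T" and v: "v \<in> H1_bd T"
  shows "\<bar>inner_bd T u v\<bar> \<le> norm_bd T (primitive_bd u) * H1_norm_bd T v"
proof -
  let ?d = "(dt T (fst v), dt T (snd v))"
  have d: "?d \<in> L2_bd T" using v by (auto simp: L2_bd_iff H1_bd_def dt_props)
  have "inner_bd T u v = - inner_bd T (primitive_bd u) ?d"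
    using u v by (auto simp: inner_bd_def primitive_bd_def L2_bd_iff H1_bd_def integration_by_parts_H1_end0)
  then show ?thesis
    using inner_bd_Cauchy_Schwarz[OF primitive_bd_L2[OF u] d] by (simp add: H1_norm_bd_def)
qed

text \<open>A concrete nonzero element, so that the supremum in \<open>dual_norm\<close> is taken
  over a nonempty set.\<close>

lemma linear_end0:
  assumes "T > 0"
  shows "(\<lambda>t. T - t) \<in> H1_end0 T"
proof -
  have "weak_deriv T (\<lambda>t. T - t) (\<lambda>t. - 1)"
    unfolding weak_deriv_def
  proof (intro allI impI)
    fix \<phi> \<phi>' :: "real \<Rightarrow> real"
    assume A: "(\<forall>t. (\<phi> has_real_derivative \<phi>' t) (at t)) \<and> continuous_on UNIV \<phi>' \<and>
      (\<exists>a b. 0 < a \<and> b < T \<and> (\<forall>t. t \<notin> {a..b} \<longrightarrow> \<phi> t = 0))"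
    then obtain a b where ab: "0 < a" "b < T" "\<And>t. t \<notin> {a..b} \<Longrightarrow> \<phi> t = 0" by blast
    have c': "continuous_on S \<phi>'" for S using A continuous_on_subset by blast
    have c: "continuous_on S \<phi>" for S using A DERIV_isCont continuous_at_imp_continuous_on by blast
    have "((\<lambda>t. (T - t) * \<phi>' t - \<phi> t) has_integral (T - T) * \<phi> T - (T - 0) * \<phi> 0) {0..T}"
    proof (rule fundamental_theorem_of_calculus)
      fix x
      have d: "(\<phi> has_real_derivative \<phi>' x) (at x)" using A by blast
      have "((\<lambda>t. (T - t) * \<phi> t) has_real_derivative (T - x) * \<phi>' x - \<phi> x) (at x)"
        using DERIV_mult[OF DERIV_diff[OF DERIV_const[of T] DERIV_ident] d] by (simp add: algebra_simps)
      then show "((\<lambda>t. (T - t) * \<phi> t) has_vector_derivative (T - x) * \<phi>' x - \<phi> x) (at x within {0..T})"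
        by (metis has_real_derivative_iff_has_vector_derivative has_vector_derivative_at_within)
    qed (use assms in auto)
    then have "integral {0..T} (\<lambda>t. (T - t) * \<phi>' t - \<phi> t) = 0"
      using ab by (simp add: integral_unique)
    moreover have "integral {0..T} (\<lambda>t. (T - t) * \<phi>' t - \<phi> t) =
        integral {0..T} (\<lambda>t. (T - t) * \<phi>' t) - integral {0..T} \<phi>"
      by (intro Henstock_Kurzweil_Integration.integral_diff integrable_continuous_interval continuous_intros c c')
    moreover have "(LINT t|lebesgue_on {0<..<T}. (T - t) * \<phi>' t) = integral {0..T} (\<lambda>t. (T - t) * \<phi>' t)"
      by (intro LINT_eq_integral L2_integrable continuous_on_L2 continuous_intros c')
    moreover have "(LINT t|lebesgue_on {0<..<T}. \<phi> t) = integral {0..T} \<phi>"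
      by (intro LINT_eq_integral L2_integrable continuous_on_L2 c)
    ultimately show "(LINT t|lebesgue_on {0<..<T}. (T - t) * \<phi>' t) = - (LINT t|lebesgue_on {0<..<T}. - 1 * \<phi> t)"
      by simp
  qed
  moreover have "(\<lambda>t. T - t) \<in> L2 T"
    by (intro continuous_on_L2 continuous_intros)
  moreover have "continuous_on {0..T} (\<lambda>t. T - t)" by (intro continuous_intros)
  ultimately show ?thesis
    unfolding H1_end0_def using L2_const[of "- 1" T] by (intro CollectI conjI bexI[of _ "\<lambda>t. - 1"]) simp_all
qed

lemma zero_end0: "(\<lambda>t. 0) \<in> H1_end0 T"
proof -
  have "weak_deriv T (\<lambda>t. 0) (\<lambda>t. 0)" by (simp add: weak_deriv_def)
  then show ?thesis unfolding H1_end0_def using L2_const[of 0 T] by (intro CollectI conjI bexI[of _ "\<lambda>t. 0"]) simp_all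
qed

lemma H1_bd_nonzero:
  assumes "T > 0"
  shows "{v \<in> H1_bd T. \<exists>t \<in> {0<..<T}. fst v t \<noteq> 0 \<or> snd v t \<noteq> 0} \<noteq> {}"
proof -
  have "((\<lambda>t. T - t), (\<lambda>t. 0)) \<in> {v \<in> H1_bd T. \<exists>t \<in> {0<..<T}. fst v t \<noteq> 0 \<or> snd v t \<noteq> 0}"
    using linear_end0[OF assms] zero_end0[of T] assms dense[of 0 T] by (auto simp: H1_bd_def)
  then show ?thesis by blast
qed

section \<open>The dual norm as a real supremum\<close>

lemma H1_norm_bd_nonneg: "0 \<le> H1_norm_bd T v"
  by (simp add: H1_norm_bd_def norm_bd_nonneg)

text \<open>The constant in \<open>H1_dual\<close> is not given as nonnegative, so its absolute
  value is the bound. It also covers quotients with denominator 0, which have the value 0.\<close>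

lemma dual_quotient_bdd_above:
  assumes "w \<in> H1_dual T"
  shows "bdd_above ((\<lambda>v. w v / H1_norm_bd T v) ` {v \<in> H1_bd T. P v})"
proof -
  obtain C where C: "\<And>v. v \<in> H1_bd T \<Longrightarrow> \<bar>w v\<bar> \<le> C * H1_norm_bd T v"
    using assms unfolding H1_dual_def by blast
  show ?thesis
  proof (rule bdd_aboveI2)
    fix v assume "v \<in> {v \<in> H1_bd T. P v}"
    then have "w v \<le> C * H1_norm_bd T v" using C[of v] by auto
    also have "\<dots> \<le> \<bar>C\<bar> * H1_norm_bd T v" by (intro mult_right_mono H1_norm_bd_nonneg) auto
    finally show "w v / H1_norm_bd T v \<le> \<bar>C\<bar>"
      using H1_norm_bd_nonneg[of T v] by (cases "H1_norm_bd T v = 0") (auto simp: pos_divide_le_eq)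
  qed
qed

text \<open>w - b is the sum of w - a and the square-integrable a - b. The quotients of the latter
  are controlled by its primitive through \<open>inner_bd_H1_bound\<close>.\<close>

lemma dual_norm_triangle:
  assumes "T > 0" and w: "dual_minus T w a \<in> H1_dual T" and a: "a \<in> L2_bd T" and b: "b \<in> L2_bd T"
  shows "dual_norm T (dual_minus T w b) \<le>
    dual_norm T (dual_minus T w a) + norm_bd T (primitive_bd (diff_bd a b))"
  unfolding dual_norm_def
proof (rule cSUP_least[OF H1_bd_nonzero[OF assms(1)]])
  fix v assume v: "v \<in> {v \<in> H1_bd T. \<exists>t\<in>{0<..<T}. fst v t \<noteq> 0 \<or> snd v t \<noteq> 0}"
  let ?N = "H1_norm_bd T v"
  have ab: "diff_bd a b \<in> L2_bd T" using a b by (simp add: diff_bd_def L2_bd_lincomb)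
  have "dual_minus T w b v = dual_minus T w a v + inner_bd T (diff_bd a b) v"
    using a b v H1_bd_L2[of v T] by (simp add: dual_minus_def diff_bd_def inner_bd_lincomb_left)
  then have "dual_minus T w b v / ?N = dual_minus T w a v / ?N + inner_bd T (diff_bd a b) v / ?N"
    by (simp add: add_divide_distrib)
  also have "dual_minus T w a v / ?N \<le>
     (SUP v\<in>{v \<in> H1_bd T. \<exists>t\<in>{0<..<T}. fst v t \<noteq> 0 \<or> snd v t \<noteq> 0}. dual_minus T w a v / H1_norm_bd T v)"
    using v by (intro cSUP_upper dual_quotient_bdd_above[OF w])
  also have "inner_bd T (diff_bd a b) v / ?N \<le> norm_bd T (primitive_bd (diff_bd a b))"
    using inner_bd_H1_bound[OF ab, of v] v H1_norm_bd_nonneg[of T v] norm_bd_nonneg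
    by (cases "?N = 0") (auto simp: pos_divide_le_eq)
  finally show "dual_minus T w b v / ?N \<le>
     (SUP v\<in>{v \<in> H1_bd T. \<exists>t\<in>{0<..<T}. fst v t \<noteq> 0 \<or> snd v t \<noteq> 0}. dual_minus T w a v / H1_norm_bd T v) +
     norm_bd T (primitive_bd (diff_bd a b))"
    by simp
qed

lemma dual_minus_H1_dual:
  assumes w: "w \<in> H1_dual T" and a: "a \<in> L2_bd T"
  shows "dual_minus T w a \<in> H1_dual T"
proof -
  obtain C where C: "\<And>v. v \<in> H1_bd T \<Longrightarrow> \<bar>w v\<bar> \<le> C * H1_norm_bd T v"
    using w unfolding H1_dual_def by blast
  have "\<bar>dual_minus T w a v\<bar> \<le> (C + norm_bd T (primitive_bd a)) * H1_norm_bd T v" if "v \<in> H1_bd T" for v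
    using C[OF that] inner_bd_H1_bound[OF a that] by (simp add: dual_minus_def algebra_simps)
  moreover have "dual_minus T w a (lincomb_bd x u y v) = x * dual_minus T w a u + y * dual_minus T w a v"
    if "u \<in> H1_bd T" "v \<in> H1_bd T" for u v x y
    using w a that by (simp add: H1_dual_def dual_minus_def inner_bd_lincomb_right H1_bd_L2 algebra_simps)
  ultimately show ?thesis unfolding H1_dual_def by blast
qed

section \<open>Coercivity of the single layer operator\<close>

text \<open>
  The values \<open>\<phi> k\<close> form, up to alternating signs, the eigenvector of the Gram matrix for its smallest
  eigenvalue \<open>c\<close> (so \<open>\<phi> (n + 1) = \<phi> n\<close>), and the inequality is the discrete Picone identity: in each step the
  square \<open>(y + x r)\<^sup>2 / r\<close> with \<open>r = \<phi> (k + 1) / \<phi> k\<close> is dropped.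
\<close>

lemma chain_coercive:
  fixes a :: "nat \<Rightarrow> real"
  assumes "a 0 = 0" "n \<ge> 1"
  shows "4 * (sin (pi / (2 * (2 * real n + 1))))\<^sup>2 * (\<Sum>k<n. (a (Suc k))\<^sup>2) \<le> (\<Sum>k<n. (a (Suc k) + a k)\<^sup>2)"
proof -
  \<comment> \<open>The angle is fixed by n \<alpha> + (n + 1) \<alpha> = \<pi>, which makes the
    sines of the two multiples agree.\<close>
  define \<alpha> where "\<alpha> = pi / (2 * real n + 1)"
  define \<phi> where "\<phi> k = sin (real k * \<alpha>)" for k
  define c where "c = 2 - 2 * cos \<alpha>"
  have c: "c = 4 * (sin (pi / (2 * (2 * real n + 1))))\<^sup>2"
  proof -
    have "\<alpha> = 2 * (pi / (2 * (2 * real n + 1)))" by (simp add: \<alpha>_def field_simps)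
    then have "cos \<alpha> = 1 - 2 * (sin (pi / (2 * (2 * real n + 1))))\<^sup>2" by (simp only: cos_double_sin)
    then show ?thesis by (simp add: c_def)
  qed
  have pos: "\<phi> k > 0" if "1 \<le> k" "k \<le> n" for k
  proof -
    have "real k * pi < (2 * real n + 1) * pi" using that by (intro mult_strict_right_mono) auto
    then have "real k * \<alpha> < pi" by (simp add: \<alpha>_def field_simps)
    moreover have "0 < real k * \<alpha>" using that by (simp add: \<alpha>_def)
    ultimately show ?thesis unfolding \<phi>_def by (intro sin_gt_zero)
  qed
  have rec: "\<phi> (Suc (Suc k)) + \<phi> k = (2 - c) * \<phi> (Suc k)" for k
  proof -
    have "\<phi> (Suc (Suc k)) = sin (real (Suc k) * \<alpha> + \<alpha>)" "\<phi> k = sin (real (Suc k) * \<alpha> - \<alpha>)"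
      by (auto simp: \<phi>_def algebra_simps)
    then show ?thesis by (simp add: sin_add sin_diff c_def \<phi>_def)
  qed
  \<comment> \<open>The invariant carries the last entry with weight
    \<open>\<phi> (Suc (Suc j)) / \<phi> (Suc j) - 1\<close>. At j = n - 1 this weight is 0 and the
    claim remains.\<close>
  have "c * (\<Sum>k<Suc j. (a (Suc k))\<^sup>2) + (a (Suc j))\<^sup>2 * (\<phi> (Suc (Suc j)) / \<phi> (Suc j) - 1)
     \<le> (\<Sum>k<Suc j. (a (Suc k) + a k)\<^sup>2)" if "j < n" for j
    using that
  proof (induction j)
    case 0
    \<comment> \<open>As \<open>\<phi> 0\<close> and \<open>a 0\<close> vanish, both sides of the
      base case equal the square of \<open>a 1\<close>.\<close>
    have eq: "\<phi> (Suc (Suc 0)) / \<phi> (Suc 0) = 2 - c"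
      using rec[of 0] pos[of 1] assms by (simp add: \<phi>_def[of 0])
    show ?case unfolding eq using assms by (simp add: algebra_simps)
  next
    case (Suc j)
    define x y r where "x = a (Suc j)" and "y = a (Suc (Suc j))" and "r = \<phi> (Suc (Suc j)) / \<phi> (Suc j)"
    have p: "\<phi> (Suc j) > 0" "\<phi> (Suc (Suc j)) > 0" using Suc.prems by (auto intro!: pos)
    then have r: "r > 0" by (simp add: r_def)
    have "\<phi> (Suc (Suc (Suc j))) / \<phi> (Suc (Suc j)) = 2 - c - 1 / r"
    proof -
      have "\<phi> (Suc (Suc (Suc j))) = (2 - c) * \<phi> (Suc (Suc j)) - \<phi> (Suc j)" using rec[of "Suc j"] by simp
      then show ?thesis using p by (simp add: r_def diff_divide_distrib)
    qed
    moreover have "0 \<le> (y + x * r)\<^sup>2 / r" using r by simp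
    then have "0 \<le> y\<^sup>2 / r + 2 * x * y + x\<^sup>2 * r"
      using r by (simp add: power2_eq_square field_simps)
    then have "c * y\<^sup>2 + y\<^sup>2 * (2 - c - 1 / r - 1) \<le> (y + x)\<^sup>2 + x\<^sup>2 * (r - 1)"
      by (simp add: power2_eq_square algebra_simps)
    moreover have "c * (\<Sum>k<Suc j. (a (Suc k))\<^sup>2) + x\<^sup>2 * (r - 1) \<le> (\<Sum>k<Suc j. (a (Suc k) + a k)\<^sup>2)"
      using Suc.IH Suc.prems by (simp add: x_def r_def)
    ultimately show ?case
      unfolding sum.lessThan_Suc[of _ "Suc j"] distrib_left
      by (simp add: x_def y_def del: sum.lessThan_Suc)
  qed
  from this[of "n - 1"] have "c * (\<Sum>k<n. (a (Suc k))\<^sup>2) + (a n)\<^sup>2 * (\<phi> (Suc n) / \<phi> n - 1)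
     \<le> (\<Sum>k<n. (a (Suc k) + a k)\<^sup>2)" using assms by (simp del: sum.lessThan_Suc)
  moreover have "\<phi> (Suc n) = \<phi> n"
  proof -
    have "real (Suc n) * \<alpha> = pi - real n * \<alpha>" by (simp add: \<alpha>_def field_simps)
    then show ?thesis by (simp only: \<phi>_def sin_pi_minus)
  qed
  ultimately show ?thesis using c pos[of n] assms by simp
qed

lemma two_chains_coercive:
  fixes F G :: "real \<Rightarrow> real"
  assumes "n \<ge> 1" and "\<And>t. t \<le> 0 \<Longrightarrow> F t = 0" "\<And>t. t \<le> 0 \<Longrightarrow> G t = 0" and "s \<le> L"
  shows "4 * (sin (pi / (2 * (2 * real n + 1))))\<^sup>2 * (\<Sum>k<n. (F (s + real k * L))\<^sup>2 + (G (s + real k * L))\<^sup>2) \<le>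
    (\<Sum>k<n. (F (s + real k * L) + G (s + real k * L - L))\<^sup>2 + (F (s + real k * L - L) + G (s + real k * L))\<^sup>2)"
proof -
  \<comment> \<open>The shift by \<open>L\<close> swaps the components, so following it decouples the system into two chains.\<close>
  define a where "a k = (if even k then F else G) (s + real k * L - L)" for k :: nat
  define b where "b k = (if even k then G else F) (s + real k * L - L)" for k :: nat
  \<comment> \<open>The chains are indexed one slab late: entry 0 is taken at s - L, which is
    nonpositive since s \<le> L.\<close>
  have "a 0 = 0" "b 0 = 0" using assms by (auto simp: a_def b_def)
  note ca = chain_coercive[of a n, OF \<open>a 0 = 0\<close> \<open>n \<ge> 1\<close>]
   and cb = chain_coercive[of b n, OF \<open>b 0 = 0\<close> \<open>n \<ge> 1\<close>]
  have 1: "(F (s + real k * L))\<^sup>2 + (G (s + real k * L))\<^sup>2 = (a (Suc k))\<^sup>2 + (b (Suc k))\<^sup>2" for k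
    by (simp add: a_def b_def algebra_simps)
  have 2: "(F (s + real k * L) + G (s + real k * L - L))\<^sup>2 + (F (s + real k * L - L) + G (s + real k * L))\<^sup>2
     = (a (Suc k) + a k)\<^sup>2 + (b (Suc k) + b k)\<^sup>2" for k
    by (simp add: a_def b_def algebra_simps)
  show ?thesis
    unfolding 1 2 sum.distrib using add_mono[OF ca cb] by (simp add: distrib_left)
qed

text \<open>Turns the time integral into an integral over one slab of a sum over all slabs, so that
  a matrix inequality for the slab values at a fixed s can be integrated in s. The second claim
  supplies the integrability.\<close>

lemma LINT_slabs:
  fixes f :: "real \<Rightarrow> real"
  assumes f: "continuous_on {0..real n * L} f" and "L > 0"
  shows "(LINT t|lebesgue_on {0<..<real n * L}. f t) = integral {0..L} (\<lambda>s. \<Sum>k<n. f (s + real k * L))"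
    and "\<And>k. k < n \<Longrightarrow> continuous_on {0..L} (\<lambda>s. f (s + real k * L))"
proof -
  have ck: "continuous_on {real k * L..real (Suc k) * L} f" if "k < n" for k
  proof (rule continuous_on_subset[OF f])
    have "real (Suc k) * L \<le> real n * L" using that assms by (intro mult_right_mono) auto
    then show "{real k * L..real (Suc k) * L} \<subseteq> {0..real n * L}"
      using assms by (auto intro: order_trans[of 0 "real k * L"])
  qed
  show cs: "continuous_on {0..L} (\<lambda>s. f (s + real k * L))" if "k < n" for k
    by (rule continuous_on_compose2[OF ck[OF that]]) (auto intro!: continuous_intros simp: algebra_simps)
  have piece: "(LINT t|lebesgue_on {real k * L<..<real (Suc k) * L}. f t) = integral {0..L} (\<lambda>s. f (s + real k * L))"
    if "k < n" for k
  proof -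
    have "real (Suc k) * L \<le> real n * L" "0 \<le> real k * L"
      using that assms by (auto intro: mult_right_mono simp del: of_nat_Suc)
    then have "{real k * L<..<real (Suc k) * L} \<subseteq> {0<..<real n * L}"
      by (meson greaterThanLessThan_iff le_less_trans less_le_trans subsetI)
    then have "integrable (lebesgue_on {real k * L<..<real (Suc k) * L}) f"
      by (intro integrable_lebesgue_on_mono[OF L2_integrable[OF continuous_on_L2[OF f]]]) auto
    then have "(LINT t|lebesgue_on {real k * L<..<real (Suc k) * L}. f t) = integral {0 + real k * L..L + real k * L} f"
      by (simp add: LINT_eq_integral algebra_simps)
    also have "\<dots> = integral {0..L} (f \<circ> (\<lambda>s. s + real k * L))"
      using ck[OF that] by (intro integral_shift[symmetric]) (simp add: algebra_simps)
    finally show ?thesis by (simp add: comp_def)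
  qed
  have "(LINT t|lebesgue_on {0<..<real n * L}. f t) = (\<Sum>k<n. integral {0..L} (\<lambda>s. f (s + real k * L)))"
    using LINT_grid_split[OF L2_integrable[OF continuous_on_L2[OF f]] \<open>L > 0\<close>] piece by simp
  also have "\<dots> = integral {0..L} (\<lambda>s. \<Sum>k<n. f (s + real k * L))"
    using cs by (intro integral_sum[symmetric] integrable_continuous_interval) auto
  finally show "(LINT t|lebesgue_on {0<..<real n * L}. f t) = integral {0..L} (\<lambda>s. \<Sum>k<n. f (s + real k * L))" .
qed

section \<open>From the matrix inequality to the operator V\<close>

lemma norm_bd_square_eq_LINT:
  assumes "u \<in> L2_bd T"
  shows "(norm_bd T u)\<^sup>2 = (LINT t|lebesgue_on {0<..<T}. (fst u t)\<^sup>2 + (snd u t)\<^sup>2)"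
  using assms by (simp add: norm_bd_square inner_bd_def L2_bd_iff L2_D power2_eq_square[symmetric])

lemma single_layer_eq:
  "fst (single_layer L u) = (\<lambda>t. 1/2 * (integral_0 (fst u) t + integral_0 (snd u) (t - L)))"
  "snd (single_layer L u) = (\<lambda>t. 1/2 * (integral_0 (fst u) (t - L) + integral_0 (snd u) t))"
  by (auto simp: single_layer_def)

lemma continuous_on_shift_integral_0:
  assumes "u \<in> L2 T" "d \<ge> 0"
  shows "continuous_on {0..T} (\<lambda>t. integral_0 u (t - d))"
  by (rule continuous_on_compose2[OF continuous_on_integral_0[OF assms(1)]])
    (use assms in \<open>auto intro!: continuous_intros\<close>)

lemma continuous_on_single_layer:
  assumes "u \<in> L2_bd T" "L \<ge> 0"
  shows "continuous_on {0..T} (fst (single_layer L u))" "continuous_on {0..T} (snd (single_layer L u))"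
  using assms continuous_on_shift_integral_0[of "fst u" T 0] continuous_on_shift_integral_0[of "snd u" T 0]
  unfolding single_layer_eq L2_bd_iff
  by (auto intro!: continuous_intros continuous_on_shift_integral_0)

lemma single_layer_L2:
  assumes "u \<in> L2_bd T" "L \<ge> 0"
  shows "single_layer L u \<in> L2_bd T"
  using continuous_on_single_layer[OF assms] by (auto simp: L2_bd_iff continuous_on_L2)

text \<open>The factor 2 of the singular value cancels the one half in \<open>single_layer\<close>;
  hence the comparison of doubled norms in the proof.\<close>

lemma primitive_le_single_layer:
  assumes u: "u \<in> L2_bd T" and L: "L > 0" and n: "n \<ge> 1" and T: "T = real n * L"
  shows "sin (pi / (2 * (2 * real n + 1))) * norm_bd T (primitive_bd u) \<le> norm_bd T (single_layer L u)"
proof -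
  define \<sigma> where "\<sigma> = sin (pi / (2 * (2 * real n + 1)))"
  define F G where "F = integral_0 (fst u)" and "G = integral_0 (snd u)"
  have c: "continuous_on {0..T} F" "continuous_on {0..T} G"
    "continuous_on {0..T} (\<lambda>t. F (t - L))" "continuous_on {0..T} (\<lambda>t. G (t - L))"
    using u L continuous_on_shift_integral_0[of "fst u" T 0] continuous_on_shift_integral_0[of "snd u" T 0]
      continuous_on_shift_integral_0[of "fst u" T L] continuous_on_shift_integral_0[of "snd u" T L]
    by (auto simp: F_def G_def L2_bd_iff)
  define P where "P t = (F t)\<^sup>2 + (G t)\<^sup>2" for t
  define Q where "Q t = (F t + G (t - L))\<^sup>2 + (F (t - L) + G t)\<^sup>2" for t
  have cP: "continuous_on {0..real n * L} P" and cQ: "continuous_on {0..real n * L} Q"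
    unfolding P_def Q_def using c T by (auto intro!: continuous_intros)
  have int: "(\<lambda>s. \<Sum>k<n. P (s + real k * L)) integrable_on {0..L}"
    "(\<lambda>s. \<Sum>k<n. Q (s + real k * L)) integrable_on {0..L}"
    using LINT_slabs(2)[OF cP L] LINT_slabs(2)[OF cQ L]
    by (auto intro!: integrable_continuous_interval continuous_on_sum)
  have "(2 * \<sigma> * norm_bd T (primitive_bd u))\<^sup>2 = 4 * \<sigma>\<^sup>2 * (LINT t|lebesgue_on {0<..<T}. P t)"
    using norm_bd_square_eq_LINT[OF primitive_bd_L2[OF u]]
    by (simp add: power_mult_distrib primitive_bd_def P_def F_def G_def)
  also have "\<dots> = integral {0..L} (\<lambda>s. 4 * \<sigma>\<^sup>2 * (\<Sum>k<n. P (s + real k * L)))"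
    by (simp add: T LINT_slabs[OF cP L])
  also have "\<dots> \<le> integral {0..L} (\<lambda>s. \<Sum>k<n. Q (s + real k * L))"
  proof (rule integral_le)
    fix s assume "s \<in> {0..L}"
    then show "4 * \<sigma>\<^sup>2 * (\<Sum>k<n. P (s + real k * L)) \<le> (\<Sum>k<n. Q (s + real k * L))"
      unfolding P_def Q_def \<sigma>_def using n
      by (intro two_chains_coercive) (auto simp: F_def G_def integral_0_nonpos)
  qed (use int integrable_cmul[OF int(1), of "4 * \<sigma>\<^sup>2"] in simp_all)
  also have "\<dots> = (LINT t|lebesgue_on {0<..<T}. Q t)"
    by (simp add: T LINT_slabs[OF cQ L])
  also have "\<dots> = (2 * norm_bd T (single_layer L u))\<^sup>2"
  proof -
    have "(fst (single_layer L u) t)\<^sup>2 + (snd (single_layer L u) t)\<^sup>2 = 1 / 4 * Q t" for t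
      by (simp add: single_layer_eq Q_def F_def G_def power2_eq_square algebra_simps)
    then have "(norm_bd T (single_layer L u))\<^sup>2 = (LINT t|lebesgue_on {0<..<T}. 1 / 4 * Q t)"
      using norm_bd_square_eq_LINT[OF single_layer_L2[OF u, of L]] L by (simp only:)
    then show ?thesis by (simp add: power_mult_distrib)
  qed
  finally have "2 * \<sigma> * norm_bd T (primitive_bd u) \<le> 2 * norm_bd T (single_layer L u)"
    by (rule power2_le_imp_le) (simp add: norm_bd_nonneg)
  then show ?thesis by (simp add: \<sigma>_def)
qed

section \<open>Uniform grids\<close>

definition grid_nodes :: "real \<Rightarrow> nat \<Rightarrow> real set" where
  "grid_nodes H K = (\<lambda>k. real k * H) ` {..K}"

lemma elements_grid_nodes:
  assumes "H > 0"
  shows "elements (grid_nodes H K) = {(real k * H, real (Suc k) * H) | k. k < K}"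
proof (intro equalityI subsetI)
  fix x assume "x \<in> elements (grid_nodes H K)"
  then obtain i j where x: "x = (real i * H, real j * H)" and ij: "j \<le> K" "real i * H < real j * H"
    and no: "{real i * H<..<real j * H} \<inter> grid_nodes H K = {}"
    by (auto simp: elements_def grid_nodes_def)
  have "i < j" using ij assms by simp
  have "j = Suc i"
  proof (rule ccontr)
    assume "j \<noteq> Suc i"
    then have "Suc i < j" using \<open>i < j\<close> by simp
    then have "real (Suc i) * H \<in> {real i * H<..<real j * H} \<inter> grid_nodes H K"
      using assms ij unfolding grid_nodes_def by (auto simp del: of_nat_Suc)
    then show False using no by blast
  qed
  then show "x \<in> {(real k * H, real (Suc k) * H) | k. k < K}" using x ij by auto
next
  fix x assume "x \<in> {(real k * H, real (Suc k) * H) | k. k < K}"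
  then obtain k where x: "x = (real k * H, real (Suc k) * H)" "k < K" by blast
  have "{real k * H<..<real (Suc k) * H} \<inter> grid_nodes H K = {}"
    using assms by (auto simp: grid_nodes_def simp del: of_nat_Suc)
  then show "x \<in> elements (grid_nodes H K)"
    using x assms unfolding elements_def grid_nodes_def by (auto simp del: of_nat_Suc)
qed

lemma refine_grid_nodes:
  assumes "H > 0" "m \<ge> 1" "K \<ge> 1"
  shows "refine_nodes m (grid_nodes H K) = grid_nodes (H / real m) (K * m)"
proof -
  have node: "real k * H + real i / real m * (real (Suc k) * H - real k * H) = real (k * m + i) * (H / real m)" for k i
    using assms by (simp add: field_simps)
  have "refine_nodes m (grid_nodes H K) = {real (k * m + i) * (H / real m) | k i. k < K \<and> i \<le> m}"
    unfolding refine_nodes_def elements_grid_nodes[OF assms(1)] node[symmetric] by blast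
  also have "\<dots> = grid_nodes (H / real m) (K * m)"
  proof (intro equalityI subsetI)
    fix x assume "x \<in> {real (k * m + i) * (H / real m) | k i. k < K \<and> i \<le> m}"
    then obtain k i where x: "x = real (k * m + i) * (H / real m)" "k < K" "i \<le> m" by blast
    have "k * m + i \<le> Suc k * m" using x by simp
    also have "\<dots> \<le> K * m" using x by (intro mult_right_mono) auto
    finally show "x \<in> grid_nodes (H / real m) (K * m)" using x(1) unfolding grid_nodes_def by blast
  next
    fix x assume "x \<in> grid_nodes (H / real m) (K * m)"
    then obtain j where x: "x = real j * (H / real m)" "j \<le> K * m" by (auto simp: grid_nodes_def)
    show "x \<in> {real (k * m + i) * (H / real m) | k i. k < K \<and> i \<le> m}"
    \<comment> \<open>The last node has no element to its right, so division with remainder would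
      give the index K. It is the right end of element K - 1 instead.\<close>
    proof (cases "j = K * m")
      case True
      have "K * m = (K - 1) * m + m" using assms by (cases K) auto
      with True x assms show ?thesis
        by (intro CollectI exI[of _ "K - 1"] exI[of _ m]) simp
    next
      case False
      then have "j div m < K" using x by (simp add: less_mult_imp_div_less)
      moreover have "j mod m \<le> m" using assms by (simp add: less_imp_le)
      moreover have "j = j div m * m + j mod m" by simp
      ultimately show ?thesis using x by (intro CollectI exI[of _ "j div m"] exI[of _ "j mod m"]) simp
    qed
  qed
  finally show ?thesis .
qed

text \<open>From every node below T the next one is exactly H further. So all multiples of H up to T
  are nodes, nothing lies between consecutive ones, and T is a multiple since otherwise the
  successor of the last one would lie beyond T.\<close>

lemma uniform_decomposition_grid:
  assumes N: "decomposition T N" and "T > 0" and H: "\<And>a b. (a, b) \<in> elements N \<Longrightarrow> b - a = H"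
  obtains K where "K \<ge> 1" "H > 0" "T = real K * H" "N = grid_nodes H K"
proof -
  have fin: "finite N" and sub: "N \<subseteq> {0..T}" and ends: "0 \<in> N" "T \<in> N"
    using N by (auto simp: decomposition_def)
  have nxt: "x + H \<in> N \<and> H > 0 \<and> {x<..<x + H} \<inter> N = {}" if "x \<in> N" "x < T" for x
  proof -
    let ?S = "{y \<in> N. x < y}"
    have S: "finite ?S" "?S \<noteq> {}" using fin ends that by auto
    have M: "Min ?S \<in> N" "x < Min ?S" using Min_in[OF S] by auto
    moreover have "{x<..<Min ?S} \<inter> N = {}"
      using Min_le[OF S(1)] by fastforce
    ultimately have "(x, Min ?S) \<in> elements N" using that by (auto simp: elements_def)
    from H[OF this] have "Min ?S = x + H" by simp
    then show ?thesis using M \<open>{x<..<Min ?S} \<inter> N = {}\<close> by auto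
  qed
  have Hpos: "H > 0" using nxt[OF ends(1) \<open>T > 0\<close>] by blast
  have inN: "real k * H \<le> T \<Longrightarrow> real k * H \<in> N" for k
  proof (induction k)
    case 0
    then show ?case using ends by simp
  next
    case (Suc k)
    then have "real k * H + H \<le> T" by (simp add: algebra_simps)
    then show ?case using Suc.IH nxt[of "real k * H"] Hpos by (auto simp: algebra_simps)
  qed
  have fl: "real (nat \<lfloor>x / H\<rfloor>) * H \<le> x" "x < real (nat \<lfloor>x / H\<rfloor>) * H + H" if "x \<ge> 0" for x
  proof -
    have f0: "0 \<le> \<lfloor>x / H\<rfloor>" using that Hpos by simp
    have "real_of_int \<lfloor>x / H\<rfloor> \<le> x / H" "x / H < real_of_int \<lfloor>x / H\<rfloor> + 1" by linarith+
    then have "real_of_int \<lfloor>x / H\<rfloor> * H \<le> x" "x < (real_of_int \<lfloor>x / H\<rfloor> + 1) * H"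
      using Hpos by (simp_all only: pos_le_divide_eq pos_divide_less_eq)
    then show "real (nat \<lfloor>x / H\<rfloor>) * H \<le> x" "x < real (nat \<lfloor>x / H\<rfloor>) * H + H"
      using f0 by (simp_all add: algebra_simps)
  qed
  define K where "K = nat \<lfloor>T / H\<rfloor>"
  have KT: "T = real K * H"
  proof (rule ccontr)
    assume "T \<noteq> real K * H"
    then have "real K * H < T" using fl(1)[of T] \<open>T > 0\<close> by (simp add: K_def)
    then have "real K * H + H \<in> N" using inN[of K] nxt[of "real K * H"] by simp
    then show False using sub fl(2)[of T] \<open>T > 0\<close> by (auto simp: K_def)
  qed
  have "N = grid_nodes H K"
  proof (intro equalityI subsetI)
    fix x assume x: "x \<in> N"
    then have x0: "0 \<le> x" "x \<le> T" using sub by auto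
    let ?k = "nat \<lfloor>x / H\<rfloor>"
    have "x = real ?k * H"
    proof (rule ccontr)
      assume "x \<noteq> real ?k * H"
      then have "real ?k * H < x" using fl(1)[OF x0(1)] by simp
      then have "{real ?k * H<..<real ?k * H + H} \<inter> N = {}" using nxt inN[of ?k] x0 by simp
      then show False using x fl[OF x0(1)] \<open>real ?k * H < x\<close> by auto
    qed
    moreover have "?k \<le> K"
    proof -
      have "x / H \<le> T / H" using x0 Hpos by (simp add: divide_right_mono)
      then show ?thesis unfolding K_def by (intro nat_mono floor_mono)
    qed
    ultimately show "x \<in> grid_nodes H K" unfolding grid_nodes_def by blast
  next
    fix x assume "x \<in> grid_nodes H K"
    then obtain k where k: "k \<le> K" "x = real k * H" by (auto simp: grid_nodes_def)
    then have "x \<le> T" using KT Hpos by (simp add: mult_right_mono)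
    then show "x \<in> N" using inN k by simp
  qed
  moreover have "K \<ge> 1" using KT \<open>T > 0\<close> by (cases K) auto
  ultimately show ?thesis using that KT Hpos by blast
qed

section \<open>Images of piecewise constants under V\<close>

lemma pw_const_grid_nodes:
  assumes "H > 0"
  shows "pw_const T (grid_nodes H K) =
    {f \<in> L2 T. \<forall>k<K. \<exists>c. AE t in lebesgue_on {real k * H<..<real (Suc k) * H}. f t = c}"
  unfolding pw_const_def elements_grid_nodes[OF assms] by blast

text \<open>The slope is the constant that u takes almost everywhere on the element; the intercept
  collects what was accumulated before it.\<close>

lemma integral_0_affine:
  assumes "H > 0" and T: "T = real K * H" and u: "u \<in> pw_const T (grid_nodes H K)" and "k < K"
  obtains \<alpha> \<beta> where "\<And>t. t \<in> {real k * H..real (Suc k) * H} \<Longrightarrow> integral_0 u t = \<alpha> + \<beta> * t"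
proof -
  obtain c where c: "AE t in lebesgue_on {real k * H<..<real (Suc k) * H}. u t = c" and uL: "u \<in> L2 T"
    using u \<open>k < K\<close> unfolding pw_const_grid_nodes[OF assms(1)] by blast
  let ?a = "real k * H"
  have a0: "0 \<le> ?a" using assms by simp
  have bT: "real (Suc k) * H \<le> T" unfolding T using assms by (intro mult_right_mono) auto
  have "integral_0 u t = (integral_0 u ?a - c * ?a) + c * t" if t: "t \<in> {?a..real (Suc k) * H}" for t
  proof -
    have tT: "t \<le> T" "?a \<le> t" using t bT by auto
    have i: "integrable (lebesgue_on {?a<..<t}) u"
      using a0 tT by (intro integrable_lebesgue_on_mono[OF L2_integrable[OF uL]]) auto
    have i0: "u integrable_on {0..t}"
      using tT by (intro LINT_eq_integral(2) integrable_lebesgue_on_mono[OF L2_integrable[OF uL]]) auto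
    have "AE s in lebesgue_on {?a<..<t}. u s = c"
    proof -
      have "AE s in lebesgue. s \<in> {?a<..<real (Suc k) * H} \<longrightarrow> u s = c"
        using c by (simp add: AE_restrict_space_iff del: of_nat_Suc)
      then have "AE s in lebesgue. s \<in> {?a<..<t} \<longrightarrow> u s = c"
        by (rule AE_mp) (use t in \<open>auto intro!: AE_I2 simp del: of_nat_Suc\<close>)
      then show ?thesis by (simp add: AE_restrict_space_iff)
    qed
    then have "(LINT s|lebesgue_on {?a<..<t}. u s) = (LINT s|lebesgue_on {?a<..<t}. c)"
      using i by (intro integral_cong_AE) auto
    also have "\<dots> = integral {?a..t} (\<lambda>s. c)"
      by (intro LINT_eq_integral finite_measure.integrable_const finite_measure_lebesgue_on_Ioo)
    also have "\<dots> = c * (t - ?a)"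
      using tT by simp
    finally have "integral {?a..t} u = c * (t - ?a)"
      by (simp add: LINT_eq_integral(1)[OF i])
    moreover have "integral {0..?a} u + integral {?a..t} u = integral {0..t} u"
      using a0 tT i0 by (intro Henstock_Kurzweil_Integration.integral_combine)
    moreover have "integral_0 u t = integral {0..t} u" "integral_0 u ?a = integral {0..?a} u"
      using tT by (auto intro!: integral_0_eq_integral[OF uL])
    ultimately show ?thesis by (simp add: algebra_simps)
  qed
  then show ?thesis using that by blast
qed

text \<open>Here L being a multiple of H is used: the shift moves element k onto element k - r, or
  to nonpositive times, where the primitive is 0.\<close>

lemma shift_integral_0_affine:
  assumes "H > 0" and T: "T = real K * H" and u: "u \<in> pw_const T (grid_nodes H K)" and "k < K"
    and L: "L = real r * H"
  obtains \<alpha> \<beta> where "\<And>t. t \<in> {real k * H..real (Suc k) * H} \<Longrightarrow> integral_0 u (t - L) = \<alpha> + \<beta> * t"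
proof (cases "r \<le> k")
  case True
  have "k - r < K" using \<open>k < K\<close> by simp
  obtain \<alpha> \<beta> where ab: "\<And>t. t \<in> {real (k - r) * H..real (Suc (k - r)) * H} \<Longrightarrow> integral_0 u t = \<alpha> + \<beta> * t"
    using integral_0_affine[OF assms(1-3) \<open>k - r < K\<close>] by blast
  have "integral_0 u (t - L) = (\<alpha> - \<beta> * L) + \<beta> * t" if "t \<in> {real k * H..real (Suc k) * H}" for t
  proof -
    have "t - L \<in> {real (k - r) * H..real (Suc (k - r)) * H}"
      using that True by (auto simp: L of_nat_diff algebra_simps)
    then show ?thesis using ab by (simp add: algebra_simps)
  qed
  then show ?thesis using that by blast
next
  case False
  have "integral_0 u (t - L) = 0 + 0 * t" if "t \<in> {real k * H..real (Suc k) * H}" for t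
  proof -
    have "real (Suc k) * H \<le> L" unfolding L using False assms by (intro mult_right_mono) auto
    then show ?thesis using that by (simp add: integral_0_nonpos del: of_nat_Suc)
  qed
  then show ?thesis using that by blast
qed

text \<open>The coefficients are arguments because the slopes determine the distance from the
  piecewise constants.\<close>

definition pw_affine :: "real \<Rightarrow> nat \<Rightarrow> (real \<Rightarrow> real) \<Rightarrow> (nat \<Rightarrow> real) \<Rightarrow> (nat \<Rightarrow> real) \<Rightarrow> bool" where
  "pw_affine H K f \<alpha> \<beta> \<longleftrightarrow> (\<forall>k<K. \<forall>t \<in> {real k * H..real (Suc k) * H}. f t = \<alpha> k + \<beta> k * t)"

lemma single_layer_pw_affine:
  assumes "H > 0" and T: "T = real K * H" and u: "u \<in> S0 T (grid_nodes H K, grid_nodes H K)"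
    and L: "L = real r * H"
  shows "\<exists>\<alpha> \<beta>. pw_affine H K (fst (single_layer L u)) \<alpha> \<beta>" "\<exists>\<alpha> \<beta>. pw_affine H K (snd (single_layer L u)) \<alpha> \<beta>"
proof -
  have uu: "fst u \<in> pw_const T (grid_nodes H K)" "snd u \<in> pw_const T (grid_nodes H K)"
    using u by (auto simp: S0_def)
  have sum: "\<exists>\<alpha> \<beta>. pw_affine H K (\<lambda>t. 1/2 * (integral_0 v t + integral_0 z (t - L))) \<alpha> \<beta>"
    if v: "v \<in> pw_const T (grid_nodes H K)" and z: "z \<in> pw_const T (grid_nodes H K)" for v z
  proof -
    have "\<exists>\<alpha> \<beta>. \<forall>t \<in> {real k * H..real (Suc k) * H}. 1/2 * (integral_0 v t + integral_0 z (t - L)) = \<alpha> + \<beta> * t"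
      if "k < K" for k
    proof -
      obtain \<alpha> \<beta> where 1: "\<And>t. t \<in> {real k * H..real (Suc k) * H} \<Longrightarrow> integral_0 v t = \<alpha> + \<beta> * t"
        using integral_0_affine[OF assms(1,2) v \<open>k < K\<close>] by blast
      obtain \<alpha>' \<beta>' where 2: "\<And>t. t \<in> {real k * H..real (Suc k) * H} \<Longrightarrow> integral_0 z (t - L) = \<alpha>' + \<beta>' * t"
        using shift_integral_0_affine[OF assms(1,2) z \<open>k < K\<close> L] by blast
      have "\<forall>t \<in> {real k * H..real (Suc k) * H}. 1/2 * (integral_0 v t + integral_0 z (t - L)) = (\<alpha> + \<alpha>') / 2 + (\<beta> + \<beta>') / 2 * t"
        by (intro ballI) (simp only: 1 2, simp add: field_simps)
      then show ?thesis by blast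
    qed
    then show ?thesis unfolding pw_affine_def by metis
  qed
  show "\<exists>\<alpha> \<beta>. pw_affine H K (fst (single_layer L u)) \<alpha> \<beta>"
    unfolding single_layer_eq by (rule sum[OF uu])
  show "\<exists>\<alpha> \<beta>. pw_affine H K (snd (single_layer L u)) \<alpha> \<beta>"
    using sum[OF uu(2,1)] unfolding single_layer_eq by (simp add: add.commute)
qed

section \<open>Midpoint projection of piecewise affine functions\<close>

text \<open>The midpoint rule is exact for affine functions. The second identity splits the square
  into the squared mean and the variance, whose average over the interval is \<beta>^2 (b - a)^2 /
  12.\<close>

lemma affine_integrals:
  fixes f :: "real \<Rightarrow> real"
  assumes "a \<le> b" and f: "\<And>t. t \<in> {a..b} \<Longrightarrow> f t = \<alpha> + \<beta> * t"
  shows "integral {a..b} f = (b - a) * f ((a + b) / 2)"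
    and "integral {a..b} (\<lambda>t. (f t)\<^sup>2) = (b - a) * (f ((a + b) / 2))\<^sup>2 + \<beta>\<^sup>2 * (b - a) ^ 3 / 12"
proof -
  have mid: "f ((a + b) / 2) = \<alpha> + \<beta> * ((a + b) / 2)" using assms by (intro f) auto
  have "((\<lambda>t. \<alpha> + \<beta> * t) has_integral (\<alpha> * b + \<beta> * b\<^sup>2 / 2) - (\<alpha> * a + \<beta> * a\<^sup>2 / 2)) {a..b}"
    using assms by (intro fundamental_theorem_of_calculus)
      (auto intro!: derivative_eq_intros simp: has_real_derivative_iff_has_vector_derivative[symmetric])
  then have "(f has_integral (\<alpha> * b + \<beta> * b\<^sup>2 / 2) - (\<alpha> * a + \<beta> * a\<^sup>2 / 2)) {a..b}"
    by (rule has_integral_eq[rotated]) (simp add: f)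
  then show "integral {a..b} f = (b - a) * f ((a + b) / 2)"
    by (simp add: integral_unique mid power2_eq_square field_simps)
  have "((\<lambda>t. (\<alpha> + \<beta> * t)\<^sup>2) has_integral (\<alpha>\<^sup>2 * b + \<alpha> * \<beta> * b\<^sup>2 + \<beta>\<^sup>2 * b ^ 3 / 3) - (\<alpha>\<^sup>2 * a + \<alpha> * \<beta> * a\<^sup>2 + \<beta>\<^sup>2 * a ^ 3 / 3)) {a..b}"
    using assms by (intro fundamental_theorem_of_calculus)
      (auto intro!: derivative_eq_intros simp: has_real_derivative_iff_has_vector_derivative[symmetric] power2_eq_square algebra_simps)
  then have "((\<lambda>t. (f t)\<^sup>2) has_integral (\<alpha>\<^sup>2 * b + \<alpha> * \<beta> * b\<^sup>2 + \<beta>\<^sup>2 * b ^ 3 / 3) - (\<alpha>\<^sup>2 * a + \<alpha> * \<beta> * a\<^sup>2 + \<beta>\<^sup>2 * a ^ 3 / 3)) {a..b}"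
    by (rule has_integral_eq[rotated]) (simp add: f)
  then show "integral {a..b} (\<lambda>t. (f t)\<^sup>2) = (b - a) * (f ((a + b) / 2))\<^sup>2 + \<beta>\<^sup>2 * (b - a) ^ 3 / 12"
    by (simp add: integral_unique mid power2_eq_square power3_eq_cube field_simps)
qed

text \<open>For f affine on each element this is the orthogonal projection onto the piecewise
  constants, the midpoint value being the mean. Open intervals keep the summands disjoint; at the
  nodes the value is 0.\<close>

definition midpoint_step :: "real \<Rightarrow> nat \<Rightarrow> (real \<Rightarrow> real) \<Rightarrow> real \<Rightarrow> real" where
  "midpoint_step h N f t =
     (\<Sum>j<N. f ((real j * h + real (Suc j) * h) / 2) * indicator {real j * h<..<real (Suc j) * h} t)"

lemma midpoint_step_eq:
  assumes "h > 0" "j < N" "t \<in> {real j * h<..<real (Suc j) * h}"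
  shows "midpoint_step h N f t = f ((real j * h + real (Suc j) * h) / 2)"
proof -
  have "indicator {real i * h<..<real (Suc i) * h} t = (if i = j then 1 else 0 :: real)" for i
  proof (cases "i = j")
    case False
    have "t \<notin> {real i * h<..<real (Suc i) * h}"
    proof
      assume "t \<in> {real i * h<..<real (Suc i) * h}"
      then have "real i * h < real (Suc j) * h" "real j * h < real (Suc i) * h"
        using assms(3) by (meson greaterThanLessThan_iff less_trans)+
      then have "i < Suc j" "j < Suc i" using assms by (simp_all del: of_nat_Suc)
      then show False using False by simp
    qed
    then show ?thesis using False by simp
  qed (use assms in simp)
  then show ?thesis unfolding midpoint_step_def using assms(2) by (simp add: if_distrib[of "(*) _"] cong: if_cong)
qed

lemma midpoint_step_L2: "midpoint_step h N f \<in> L2 T"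
proof (rule bounded_measurable_L2)
  show "midpoint_step h N f \<in> borel_measurable (lebesgue_on {0<..<T})"
    unfolding midpoint_step_def
    by (intro borel_measurable_sum borel_measurable_times borel_measurable_indicator_lebesgue_on) auto
  fix t
  show "\<bar>midpoint_step h N f t\<bar> \<le> (\<Sum>j<N. \<bar>f ((real j * h + real (Suc j) * h) / 2)\<bar>)"
    unfolding midpoint_step_def
    by (rule order_trans[OF sum_abs sum_mono]) (auto simp: indicator_def)
qed

lemma midpoint_step_pw_const:
  assumes "h > 0"
  shows "midpoint_step h N f \<in> pw_const T (grid_nodes h N)"
  unfolding pw_const_grid_nodes[OF assms]
  using midpoint_step_eq[OF assms] by (auto simp: midpoint_step_L2 intro!: AE_I2)

lemma pw_affine_refine:
  assumes "pw_affine H K f \<alpha> \<beta>" "m \<ge> 1" "H > 0"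
  shows "pw_affine (H / real m) (K * m) f (\<lambda>j. \<alpha> (j div m)) (\<lambda>j. \<beta> (j div m))"
  unfolding pw_affine_def
proof (intro allI impI ballI)
  fix j t assume j: "j < K * m" and t: "t \<in> {real j * (H / real m)..real (Suc j) * (H / real m)}"
  have "j div m < K" using j by (simp add: less_mult_imp_div_less)
  moreover have "real (j div m) * H \<le> real j * (H / real m)"
  proof -
    have "real (j div m * m) \<le> real j" by (simp only: of_nat_le_iff) simp
    then show ?thesis using assms by (simp add: field_simps flip: of_nat_mult)
  qed
  moreover have "real (Suc j) * (H / real m) \<le> real (Suc (j div m)) * H"
  proof -
    have "Suc j \<le> Suc (j div m) * m"
      using assms(2) dividend_less_div_times[of m j] by simp
    then have "real (Suc j) \<le> real (Suc (j div m)) * real m" by (metis of_nat_le_iff of_nat_mult)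
    then have "real (Suc j) * H \<le> real (Suc (j div m)) * real m * H"
      using assms by (intro mult_right_mono) auto
    then show ?thesis using assms by (simp add: field_simps)
  qed
  ultimately have "j div m < K" "t \<in> {real (j div m) * H..real (Suc (j div m)) * H}"
    using t by (auto simp del: of_nat_Suc)
  then show "f t = \<alpha> (j div m) + \<beta> (j div m) * t"
    using assms(1) unfolding pw_affine_def by blast
qed

lemma sum_div_blocks: "(\<Sum>j<K * m. x (j div m)) = real m * (\<Sum>k<K. x k :: real)"
proof -
  have "(\<Sum>j<K * m. x (j div m)) = (\<Sum>k<K. \<Sum>j\<in>{k * m..<k * m + m}. x (j div m))"
    by (rule sum.nat_group[symmetric])
  also have "\<dots> = (\<Sum>k<K. \<Sum>j\<in>{k * m..<k * m + m}. x k)"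
  proof (intro sum.cong refl)
    fix k j assume "j \<in> {k * m..<k * m + m}"
    then have "j div m = k" by (intro div_nat_eqI) (auto simp: algebra_simps)
    then show "x (j div m) = x k" by simp
  qed
  finally show ?thesis by (simp add: sum_distrib_left)
qed

lemma integrable_element:
  fixes f :: "real \<Rightarrow> real"
  assumes "integrable (lebesgue_on {0<..<real N * h}) f" "h > 0" "j < N"
  shows "integrable (lebesgue_on {real j * h<..<real (Suc j) * h}) f"
proof (rule integrable_lebesgue_on_mono[OF assms(1)])
  have "real (Suc j) * h \<le> real N * h" "0 \<le> real j * h"
    using assms by (auto intro: mult_right_mono simp del: of_nat_Suc)
  then show "{real j * h<..<real (Suc j) * h} \<subseteq> {0<..<real N * h}"
    by (meson greaterThanLessThan_iff le_less_trans less_le_trans subsetI)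
qed auto

text \<open>On each element p is almost everywhere constant, so only the mean of f counts.\<close>

lemma midpoint_step_projection:
  assumes h: "h > 0" and T: "T = real N * h" and f: "f \<in> L2 T" and aff: "pw_affine h N f \<alpha> \<beta>"
    and p: "p \<in> pw_const T (grid_nodes h N)"
  shows "(LINT t|lebesgue_on {0<..<T}. p t * f t) = (LINT t|lebesgue_on {0<..<T}. p t * midpoint_step h N f t)"
proof -
  have pL: "p \<in> L2 T" using p by (simp add: pw_const_def)
  have i1: "integrable (lebesgue_on {0<..<real N * h}) (\<lambda>t. p t * f t)"
    and i2: "integrable (lebesgue_on {0<..<real N * h}) (\<lambda>t. p t * midpoint_step h N f t)"
    using L2_mult_integrable[OF pL f] L2_mult_integrable[OF pL midpoint_step_L2] T by auto
  have "(LINT t|lebesgue_on {real j * h<..<real (Suc j) * h}. p t * f t) =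
        (LINT t|lebesgue_on {real j * h<..<real (Suc j) * h}. p t * midpoint_step h N f t)" if j: "j < N" for j
  proof -
    let ?a = "real j * h" and ?b = "real (Suc j) * h"
    let ?M = "lebesgue_on {?a<..<?b}" and ?v = "f ((?a + ?b) / 2)"
    obtain c where c: "AE t in ?M. p t = c"
      using p j unfolding pw_const_grid_nodes[OF h] by blast
    have mf: "f \<in> borel_measurable ?M"
      using integrable_element[OF L2_integrable[OF f, unfolded T] h j] by auto
    have fi: "integrable ?M f"
      using integrable_element[OF L2_integrable[OF f, unfolded T] h j] .
    have "(LINT t|?M. p t * f t) = (LINT t|?M. c * f t)"
      using c integrable_element[OF i1 h j] fi by (intro integral_cong_AE) auto
    also have "\<dots> = c * integral {?a..?b} f"
      using LINT_eq_integral(1)[OF fi] by simp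
    also have "\<dots> = c * integral {?a..?b} (\<lambda>t. ?v)"
    proof -
      have "?a \<le> ?b" using h by simp
      moreover have "\<And>t. t \<in> {?a..?b} \<Longrightarrow> f t = \<alpha> j + \<beta> j * t"
        using aff j unfolding pw_affine_def by blast
      ultimately have "integral {?a..?b} f = (?b - ?a) * ?v" by (rule affine_integrals(1))
      then show ?thesis using h by simp
    qed
    also have "integral {?a..?b} (\<lambda>t. ?v) = (LINT t|?M. ?v)"
      by (intro LINT_eq_integral(1)[symmetric] finite_measure.integrable_const finite_measure_lebesgue_on_Ioo)
    also have "c * (LINT t|?M. ?v) = (LINT t|?M. c * ?v)"
      by (rule integral_mult_right_zero[symmetric])
    also have "\<dots> = (LINT t|?M. p t * midpoint_step h N f t)"
    proof (rule integral_cong_AE)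
      show "AE t in ?M. c * ?v = p t * midpoint_step h N f t"
        using c AE_space by eventually_elim (simp add: midpoint_step_eq[OF h j] del: of_nat_Suc)
    qed (use integrable_element[OF i2 h j] in auto)
    finally show ?thesis .
  qed
  then show ?thesis
    using LINT_grid_split[OF i1 h] LINT_grid_split[OF i2 h] T by simp
qed

text \<open>The projection loses exactly the variance. On a coarse element this would be \<beta>^2
  H^3 / 12, at most the integral of f^2. Cutting into m pieces gives m terms with H^3 / m^3, so the
  loss is the fraction 1/m^2 of that.\<close>

lemma midpoint_step_lower_bound:
  assumes H: "H > 0" and m: "m > 2" and T: "T = real K * H" and f: "f \<in> L2 T" and aff: "pw_affine H K f \<alpha> \<beta>"
  shows "((real m - 2) / (2 * real m))\<^sup>2 * (LINT t|lebesgue_on {0<..<T}. (f t)\<^sup>2) \<le>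
     (LINT t|lebesgue_on {0<..<T}. (midpoint_step (H / real m) (K * m) f t)\<^sup>2)"
proof -
  define h where "h = H / real m"
  have h: "h > 0" "H = real m * h" using H m by (auto simp: h_def)
  have Th: "T = real (K * m) * h" using T h by simp
  have affh: "pw_affine h (K * m) f (\<lambda>j. \<alpha> (j div m)) (\<lambda>j. \<beta> (j div m))"
    unfolding h_def using aff m H by (intro pw_affine_refine) auto
  define B where "B = (\<Sum>k<K. (\<beta> k)\<^sup>2)"
  define I where "I = (LINT t|lebesgue_on {0<..<T}. (f t)\<^sup>2)"
  note f2 = L2_D(2)[OF f] and q2 = L2_D(2)[OF midpoint_step_L2[of h "K * m" f T]]
  have coarse: "B * H ^ 3 / 12 \<le> I"
  proof -
    have "(\<beta> k)\<^sup>2 * H ^ 3 / 12 \<le> (LINT t|lebesgue_on {real k * H<..<real (Suc k) * H}. (f t)\<^sup>2)" if "k < K" for k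
    proof -
      let ?a = "real k * H" and ?b = "real (Suc k) * H"
      have ab: "?a \<le> ?b" "?b - ?a = H" using H by (auto simp: algebra_simps)
      have "\<And>t. t \<in> {?a..?b} \<Longrightarrow> f t = \<alpha> k + \<beta> k * t"
        using aff that unfolding pw_affine_def by blast
      from affine_integrals(2)[OF ab(1) this]
      have "(\<beta> k)\<^sup>2 * H ^ 3 / 12 \<le> integral {?a..?b} (\<lambda>t. (f t)\<^sup>2)" unfolding ab(2) using H by simp
      then show ?thesis
        using LINT_eq_integral(1)[OF integrable_element[OF f2[unfolded T] H that]] by simp
    qed
    then have "(\<Sum>k<K. (\<beta> k)\<^sup>2 * H ^ 3 / 12) \<le> I"
      unfolding I_def T LINT_grid_split[OF f2[unfolded T] H] by (intro sum_mono) auto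
    then show ?thesis by (simp add: B_def sum_distrib_right sum_divide_distrib)
  qed
  have "(LINT t|lebesgue_on {0<..<T}. (midpoint_step h (K * m) f t)\<^sup>2) =
     (\<Sum>j<K * m. (LINT t|lebesgue_on {real j * h<..<real (Suc j) * h}. (f t)\<^sup>2) - (\<beta> (j div m))\<^sup>2 * h ^ 3 / 12)"
    unfolding Th LINT_grid_split[OF q2[unfolded Th] h(1)]
  proof (intro sum.cong refl)
    fix j assume "j \<in> {..<K * m}"
    then have j: "j < K * m" by simp
    let ?a = "real j * h" and ?b = "real (Suc j) * h"
    let ?v = "f ((?a + ?b) / 2)"
    have ab: "?a \<le> ?b" "?b - ?a = h" using h by (auto simp: algebra_simps)
    have af: "\<And>t. t \<in> {?a..?b} \<Longrightarrow> f t = \<alpha> (j div m) + \<beta> (j div m) * t"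
      using affh j unfolding pw_affine_def by blast
    have "(LINT t|lebesgue_on {?a<..<?b}. (midpoint_step h (K * m) f t)\<^sup>2) = (LINT t|lebesgue_on {?a<..<?b}. ?v\<^sup>2)"
      by (intro Bochner_Integration.integral_cong refl) (simp add: midpoint_step_eq[OF h(1) j])
    also have "\<dots> = integral {?a..?b} (\<lambda>t. ?v\<^sup>2)"
      by (intro LINT_eq_integral(1) finite_measure.integrable_const finite_measure_lebesgue_on_Ioo)
    also have "\<dots> = h * ?v\<^sup>2" using ab by simp
    also have "\<dots> = integral {?a..?b} (\<lambda>t. (f t)\<^sup>2) - (\<beta> (j div m))\<^sup>2 * h ^ 3 / 12"
      using affine_integrals(2)[OF ab(1) af] unfolding ab(2) by simp
    finally show "(LINT t|lebesgue_on {?a<..<?b}. (midpoint_step h (K * m) f t)\<^sup>2) =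
        (LINT t|lebesgue_on {?a<..<?b}. (f t)\<^sup>2) - (\<beta> (j div m))\<^sup>2 * h ^ 3 / 12"
      using LINT_eq_integral(1)[OF integrable_element[OF f2[unfolded Th] h(1) j]] by simp
  qed
  also have "\<dots> = I - (\<Sum>j<K * m. (\<beta> (j div m))\<^sup>2 * h ^ 3 / 12)"
    unfolding I_def Th LINT_grid_split[OF f2[unfolded Th] h(1)] by (rule sum_subtractf)
  also have "(\<Sum>j<K * m. (\<beta> (j div m))\<^sup>2 * h ^ 3 / 12) = real m * B * h ^ 3 / 12"
    using sum_div_blocks[of "\<lambda>k. (\<beta> k)\<^sup>2 * h ^ 3 / 12" m K]
    by (simp add: B_def sum_distrib_right sum_divide_distrib sum_distrib_left mult.assoc)
  also have "real m * B * h ^ 3 / 12 = (B * H ^ 3 / 12) / (real m)\<^sup>2"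
    using m by (simp add: h_def power2_eq_square power3_eq_cube field_simps)
  finally have eq: "(LINT t|lebesgue_on {0<..<T}. (midpoint_step h (K * m) f t)\<^sup>2) = I - (B * H ^ 3 / 12) / (real m)\<^sup>2" .
  have "(B * H ^ 3 / 12) / (real m)\<^sup>2 \<le> I / (real m)\<^sup>2"
    using coarse by (intro divide_right_mono) auto
  moreover have "((real m - 2) / (2 * real m))\<^sup>2 * I \<le> I - I / (real m)\<^sup>2"
  proof -
    have "I \<ge> 0" unfolding I_def by simp
    \<comment> \<open>The left side is below 1/4, while m > 2 puts the right side at 8/9 or
      more.\<close>
    moreover have "((real m - 2) / (2 * real m))\<^sup>2 \<le> 1 - 1 / (real m)\<^sup>2"
    proof -
      have "(real m - 2)\<^sup>2 + 4 \<le> 4 * (real m)\<^sup>2"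
      proof -
        have "2 < real m" "0 \<le> real m * real m" using m by simp_all
        then have "8 \<le> real m * 4 + real m * real m * 3" by linarith
        then show ?thesis by (simp add: power2_eq_square algebra_simps)
      qed
      then show ?thesis using m by (simp add: power_divide power_mult_distrib divide_simps)
    qed
    ultimately have "((real m - 2) / (2 * real m))\<^sup>2 * I \<le> (1 - 1 / (real m)\<^sup>2) * I"
      by (intro mult_right_mono)
    then show ?thesis by (simp add: algebra_simps)
  qed
  ultimately show ?thesis using eq by (simp add: I_def h_def)
qed

section \<open>The mixed formulation\<close>

lemma dual_norm_cong:
  assumes "\<And>v. v \<in> H1_bd T \<Longrightarrow> w v = w' v"
  shows "dual_norm T w = dual_norm T w'"
  unfolding dual_norm_def using assms by (intro SUP_cong) auto

lemma norm_bd_cong: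
  assumes "\<And>t. t \<in> {0<..<T} \<Longrightarrow> fst u t = fst v t \<and> snd u t = snd v t"
  shows "norm_bd T u = norm_bd T v"
  unfolding norm_bd_def inner_bd_def using assms
  by (intro arg_cong[of _ _ sqrt] arg_cong2[of _ _ _ _ "(+)"] Bochner_Integration.integral_cong) auto

lemma integral_0_lincomb:
  assumes "u \<in> L2 T" "v \<in> L2 T" "t \<le> T"
  shows "integral_0 (\<lambda>s. a * u s + b * v s) t = a * integral_0 u t + b * integral_0 v t"
proof -
  have "integrable (lebesgue_on {0<..<t}) u" "integrable (lebesgue_on {0<..<t}) v"
    using assms by (auto intro!: integrable_lebesgue_on_mono[OF L2_integrable])
  then show ?thesis by (simp add: integral_0_def)
qed

lemma single_layer_lincomb:
  assumes "u \<in> L2_bd T" "v \<in> L2_bd T" "t \<le> T" "L \<ge> 0"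
  shows "fst (single_layer L (lincomb_bd a u b v)) t = fst (lincomb_bd a (single_layer L u) b (single_layer L v)) t"
    and "snd (single_layer L (lincomb_bd a u b v)) t = snd (lincomb_bd a (single_layer L u) b (single_layer L v)) t"
proof -
  have "fst u \<in> L2 T" "snd u \<in> L2 T" "fst v \<in> L2 T" "snd v \<in> L2 T" "t - L \<le> T"
    using assms by (auto simp: L2_bd_iff)
  note lin = integral_0_lincomb[OF this(1,3)] integral_0_lincomb[OF this(2,4)]
  show "fst (single_layer L (lincomb_bd a u b v)) t = fst (lincomb_bd a (single_layer L u) b (single_layer L v)) t"
    and "snd (single_layer L (lincomb_bd a u b v)) t = snd (lincomb_bd a (single_layer L u) b (single_layer L v)) t"
    unfolding single_layer_eq lincomb_bd_simps
    using \<open>t \<le> T\<close> \<open>t - L \<le> T\<close> by (simp_all add: lin algebra_simps)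
qed

text \<open>Subtracting a from every member of an approximating sequence of w leaves both limits
  unchanged. This makes the bound by \<open>c\<^sub>2\<close> applicable to the error of an
  arbitrary discrete function.\<close>

lemma single_layer_ext_minus:
  assumes ext: "single_layer_ext T L w g" and a: "a \<in> L2_bd T" and "L \<ge> 0"
  shows "single_layer_ext T L (dual_minus T w a) (diff_bd g (single_layer L a))"
proof -
  obtain u where u: "\<And>k::nat. u k \<in> L2_bd T"
    and lim1: "(\<lambda>k. dual_norm T (dual_minus T w (u k))) \<longlonglongrightarrow> 0"
    and lim2: "(\<lambda>k. norm_bd T (diff_bd (single_layer L (u k)) g)) \<longlonglongrightarrow> 0"
    and wg: "w \<in> H1_dual T" "g \<in> L2_bd T"
    using ext unfolding single_layer_ext_def by blast
  define z where "z k = diff_bd (u k) a" for k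
  have z: "z k \<in> L2_bd T" for k using u a by (simp add: z_def diff_bd_def L2_bd_lincomb)
  have "dual_norm T (dual_minus T (dual_minus T w a) (z k)) = dual_norm T (dual_minus T w (u k))" for k
    by (rule dual_norm_cong)
      (use u a in \<open>simp add: dual_minus_def z_def diff_bd_def inner_bd_lincomb_left H1_bd_L2\<close>)
  then have l1: "(\<lambda>k. dual_norm T (dual_minus T (dual_minus T w a) (z k))) \<longlonglongrightarrow> 0"
    using lim1 by simp
  have "norm_bd T (diff_bd (single_layer L (z k)) (diff_bd g (single_layer L a))) =
      norm_bd T (diff_bd (single_layer L (u k)) g)" for k
    by (rule norm_bd_cong)
      (use single_layer_lincomb[OF u[of k] a _ \<open>L \<ge> 0\<close>] in \<open>simp add: z_def diff_bd_def\<close>)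
  then have l2: "(\<lambda>k. norm_bd T (diff_bd (single_layer L (z k)) (diff_bd g (single_layer L a)))) \<longlonglongrightarrow> 0"
    using lim2 by simp
  have "diff_bd g (single_layer L a) \<in> L2_bd T"
    using wg a single_layer_L2[OF a \<open>L \<ge> 0\<close>] by (simp add: diff_bd_def L2_bd_lincomb)
  then show ?thesis
    unfolding single_layer_ext_def using dual_minus_H1_dual[OF wg(1) a] z l1 l2 by blast
qed

lemma pw_const_lincomb:
  assumes H: "H > 0" and "f \<in> pw_const T (grid_nodes H K)" "g \<in> pw_const T (grid_nodes H K)"
  shows "(\<lambda>t. a * f t + b * g t) \<in> pw_const T (grid_nodes H K)"
proof -
  have "\<exists>c. AE t in lebesgue_on {real k * H<..<real (Suc k) * H}. a * f t + b * g t = c" if k: "k < K" for k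
  proof -
    obtain c d where "AE t in lebesgue_on {real k * H<..<real (Suc k) * H}. f t = c"
      "AE t in lebesgue_on {real k * H<..<real (Suc k) * H}. g t = d"
      using assms k unfolding pw_const_grid_nodes[OF H] by blast
    then have "AE t in lebesgue_on {real k * H<..<real (Suc k) * H}. a * f t + b * g t = a * c + b * d"
      by eventually_elim simp
    then show ?thesis by blast
  qed
  then show ?thesis using assms unfolding pw_const_grid_nodes[OF H] by (simp add: L2_lincomb)
qed

lemma S0_L2: "u \<in> S0 T M \<Longrightarrow> u \<in> L2_bd T"
  by (auto simp: S0_def pw_const_def L2_bd_iff)

lemma S0_diff:
  assumes "H > 0" "M = (grid_nodes H K, grid_nodes H K)" "u \<in> S0 T M" "v \<in> S0 T M"
  shows "diff_bd u v \<in> S0 T M"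
  using assms(3,4) unfolding assms(2) S0_def diff_bd_def mem_Times_iff lincomb_bd_simps fst_conv snd_conv
  by (intro conjI pw_const_lincomb[OF assms(1)]) simp_all

lemma single_layer_discrete_projection:
  assumes H: "H > 0" and T: "T = real K * H" and L: "L = real r * H" and m: "m > 2"
    and MH: "M\<^sub>H = (grid_nodes H K, grid_nodes H K)"
    and Mh: "M\<^sub>h = (grid_nodes (H / real m) (K * m), grid_nodes (H / real m) (K * m))"
    and d: "d \<in> S0 T M\<^sub>H"
  obtains q where "q \<in> S0 T M\<^sub>h"
    and "\<And>p. p \<in> S0 T M\<^sub>h \<Longrightarrow> inner_bd T p (single_layer L d) = inner_bd T p q"
    and "(real m - 2) / (2 * real m) * norm_bd T (single_layer L d) \<le> norm_bd T q"
proof -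
  define f g where "f = fst (single_layer L d)" and "g = snd (single_layer L d)"
  define h where "h = H / real m"
  have h: "h > 0" using H m by (simp add: h_def)
  have Th: "T = real (K * m) * h" using T m by (simp add: h_def)
  have "L \<ge> 0" using L H by simp
  have VL: "single_layer L d \<in> L2_bd T" by (rule single_layer_L2[OF S0_L2[OF d] \<open>L \<ge> 0\<close>])
  have fg: "f \<in> L2 T" "g \<in> L2 T" using VL by (auto simp: L2_bd_iff f_def g_def)
  obtain \<alpha> \<beta> where affF: "pw_affine H K f \<alpha> \<beta>"
    using single_layer_pw_affine(1)[OF H T d[unfolded MH] L] unfolding f_def by blast
  obtain \<alpha>' \<beta>' where affG: "pw_affine H K g \<alpha>' \<beta>'"
    using single_layer_pw_affine(2)[OF H T d[unfolded MH] L] unfolding g_def by blast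
  have "m \<ge> 1" using m by simp
  note affFh = pw_affine_refine[OF affF \<open>m \<ge> 1\<close> H, folded h_def]
   and affGh = pw_affine_refine[OF affG \<open>m \<ge> 1\<close> H, folded h_def]
  define q where "q = (midpoint_step h (K * m) f, midpoint_step h (K * m) g)"
  have qS: "q \<in> S0 T M\<^sub>h"
    by (simp add: q_def S0_def Mh midpoint_step_pw_const[OF h] flip: h_def)
  have orth: "inner_bd T p (single_layer L d) = inner_bd T p q" if "p \<in> S0 T M\<^sub>h" for p
  proof -
    have "fst p \<in> pw_const T (grid_nodes h (K * m))" "snd p \<in> pw_const T (grid_nodes h (K * m))"
      using that by (auto simp: S0_def Mh h_def)
    then show ?thesis
      using midpoint_step_projection[OF h Th fg(1) affFh] midpoint_step_projection[OF h Th fg(2) affGh]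
      by (simp add: inner_bd_def q_def f_def g_def)
  qed
  define \<kappa> where "\<kappa> = (real m - 2) / (2 * real m)"
  have "\<kappa>\<^sup>2 * inner_bd T (single_layer L d) (single_layer L d) \<le> inner_bd T q q"
    using midpoint_step_lower_bound[OF H m T fg(1) affF] midpoint_step_lower_bound[OF H m T fg(2) affG]
    by (simp add: inner_bd_def q_def power2_eq_square[symmetric] distrib_left add_mono \<kappa>_def f_def g_def h_def)
  then have "(\<kappa> * norm_bd T (single_layer L d))\<^sup>2 \<le> (norm_bd T q)\<^sup>2"
    by (simp add: power_mult_distrib norm_bd_square)
  then have "\<kappa> * norm_bd T (single_layer L d) \<le> norm_bd T q"
    by (rule power2_le_imp_le) (rule norm_bd_nonneg)
  with qS orth show ?thesis using that by (simp add: \<kappa>_def)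
qed

lemma mixed_solution_stability:
  assumes H: "H > 0" and T: "T = real K * H" and L: "L = real r * H" and m: "m > 2"
    and MH: "M\<^sub>H = (grid_nodes H K, grid_nodes H K)"
    and Mh: "M\<^sub>h = (grid_nodes (H / real m) (K * m), grid_nodes (H / real m) (K * m))"
    and g: "g \<in> L2_bd T" and mixed: "mixed_solution T L M\<^sub>h M\<^sub>H g p\<^sub>h w\<^sub>H" and v: "v \<in> S0 T M\<^sub>H"
  shows "(real m - 2) / (2 * real m) * norm_bd T (single_layer L (diff_bd v w\<^sub>H)) \<le>
    norm_bd T (diff_bd g (single_layer L v))"
proof -
  have p: "p\<^sub>h \<in> S0 T M\<^sub>h" and wH: "w\<^sub>H \<in> S0 T M\<^sub>H"
    and eq: "\<And>q. q \<in> S0 T M\<^sub>h \<Longrightarrow> inner_bd T p\<^sub>h q + inner_bd T (single_layer L w\<^sub>H) q = inner_bd T g q"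
    and orth: "\<And>v. v \<in> S0 T M\<^sub>H \<Longrightarrow> inner_bd T p\<^sub>h (single_layer L v) = 0"
    using mixed unfolding mixed_solution_def by blast+
  have L0: "L \<ge> 0" using L H by simp
  define d where "d = diff_bd v w\<^sub>H"
  have d: "d \<in> S0 T M\<^sub>H" unfolding d_def by (rule S0_diff[OF H MH v wH])
  obtain q where q: "q \<in> S0 T M\<^sub>h"
    and qo: "\<And>p. p \<in> S0 T M\<^sub>h \<Longrightarrow> inner_bd T p (single_layer L d) = inner_bd T p q"
    and ql: "(real m - 2) / (2 * real m) * norm_bd T (single_layer L d) \<le> norm_bd T q"
    using single_layer_discrete_projection[OF H T L m MH Mh d] by blast
  let ?r = "diff_bd g (single_layer L v)"
  note L2 = S0_L2[OF q] S0_L2[OF v] S0_L2[OF wH] g single_layer_L2[OF S0_L2[OF v] L0]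
    single_layer_L2[OF S0_L2[OF wH] L0] single_layer_L2[OF S0_L2[OF d] L0]
  have Vd: "inner_bd T (single_layer L d) q = inner_bd T (single_layer L v) q - inner_bd T (single_layer L w\<^sub>H) q"
  proof -
    have "inner_bd T (single_layer L d) q = inner_bd T (lincomb_bd 1 (single_layer L v) (- 1) (single_layer L w\<^sub>H)) q"
      unfolding inner_bd_def d_def diff_bd_def
      using single_layer_lincomb[OF L2(2,3) _ L0, of _ 1 "- 1"]
      by (intro arg_cong2[of _ _ _ _ "(+)"] Bochner_Integration.integral_cong) auto
    then show ?thesis using L2 by (simp add: inner_bd_lincomb_left)
  qed
  \<comment> \<open>Since q lies in the fine space itself, it may be inserted in its own projection
    property.\<close>
  have "(norm_bd T q)\<^sup>2 = inner_bd T (single_layer L d) q"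
    using qo[OF q] by (simp add: norm_bd_square inner_bd_commute)
  \<comment> \<open>\<open>p\<^sub>h\<close> is in the fine space and does not distinguish q from V
    d, to which the second equation makes it orthogonal. So \<open>p\<^sub>h\<close> drops out of
    the first equation.\<close>
  moreover have "inner_bd T p\<^sub>h q = 0" using qo[OF p] orth[OF d] by simp
  ultimately have "(norm_bd T q)\<^sup>2 = - inner_bd T ?r q"
    using eq[OF q] Vd L2 by (simp add: diff_bd_def inner_bd_lincomb_left)
  also have "\<dots> \<le> norm_bd T ?r * norm_bd T q"
    using inner_bd_Cauchy_Schwarz[of ?r T q] L2 by (simp add: diff_bd_def L2_bd_lincomb)
  finally have "norm_bd T q * norm_bd T q \<le> norm_bd T ?r * norm_bd T q"
    by (simp add: power2_eq_square)
  then have "norm_bd T q \<le> norm_bd T ?r"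
    using norm_bd_nonneg[of T q] norm_bd_nonneg[of T ?r] by (cases "norm_bd T q = 0") auto
  with ql show ?thesis by (simp add: d_def)
qed

theorem lemma3p3:
  fixes L T c\<^sub>2 :: real and n m :: nat
    and M\<^sub>H M\<^sub>h :: mesh and g p\<^sub>h w\<^sub>H :: bfun and w :: "bfun \<Rightarrow> real"
  assumes "L > 0" and "n \<ge> 1" and "T = real n * L"
    and "is_mesh T M\<^sub>H" and "uniform_mesh M\<^sub>H"
    and "\<And>j. j \<le> n \<Longrightarrow> real j * L \<in> fst M\<^sub>H \<and> real j * L \<in> snd M\<^sub>H"
    and "m > 2" and "M\<^sub>h = refine_mesh m M\<^sub>H"
    and "c\<^sub>2 > 0"
    and "\<And>v f. single_layer_ext T L v f \<Longrightarrow> norm_bd T f \<le> c\<^sub>2 * dual_norm T v"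
    and "g \<in> L2_bd T" and "w \<in> H1_dual T" and "single_layer_ext T L w g"
    and "mixed_solution T L M\<^sub>h M\<^sub>H g p\<^sub>h w\<^sub>H"
  shows "dual_norm T (dual_minus T w w\<^sub>H) \<le>
    (1 + 2 * real m * c\<^sub>2 / (sin (pi / (2 * (2 * real n + 1))) * (real m - 2))) *
      (INF v\<^sub>H \<in> S0 T M\<^sub>H. dual_norm T (dual_minus T w v\<^sub>H))"
proof -
  have "T > 0" using assms(1-3) by simp
  obtain H where H: "\<And>a b. (a, b) \<in> elements (fst M\<^sub>H) \<union> elements (snd M\<^sub>H) \<Longrightarrow> b - a = H"
    using assms(5) unfolding uniform_mesh_def by blast
  have dec: "decomposition T (fst M\<^sub>H)" "decomposition T (snd M\<^sub>H)"
    using assms(4) by (auto simp: is_mesh_def)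
  obtain K where K: "K \<ge> 1" "H > 0" "T = real K * H" "fst M\<^sub>H = grid_nodes H K"
    using uniform_decomposition_grid[OF dec(1) \<open>T > 0\<close>, of H] H by blast
  obtain K' where K': "T = real K' * H" "snd M\<^sub>H = grid_nodes H K'"
    using uniform_decomposition_grid[OF dec(2) \<open>T > 0\<close>, of H] H by blast
  \<comment> \<open>Uniformity refers to both components together, so they share H and hence the
    number of elements.\<close>
  have "K' = K" using K K' by simp
  then have MH: "M\<^sub>H = (grid_nodes H K, grid_nodes H K)" using K K' by (simp add: prod_eq_iff)
  have "m \<ge> 1" using assms(7) by simp
  then have Mh: "M\<^sub>h = (grid_nodes (H / real m) (K * m), grid_nodes (H / real m) (K * m))"
    using refine_grid_nodes[OF K(2) _ K(1), of m] unfolding assms(8) MH refine_mesh_def by simp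
  \<comment> \<open>The case j = 1 of the node condition, admissible because n \<ge> 1.\<close>
  obtain r where r: "L = real r * H"
    using assms(6)[of 1] assms(2) by (auto simp: MH grid_nodes_def)
  have L0: "L \<ge> 0" using assms(1) by simp
  define \<sigma> where "\<sigma> = sin (pi / (2 * (2 * real n + 1)))"
  define \<kappa> where "\<kappa> = (real m - 2) / (2 * real m)"
  have "pi / (2 * (2 * real n + 1)) < pi / 1" by (intro divide_strict_left_mono) auto
  then have \<sigma>: "\<sigma> > 0" unfolding \<sigma>_def by (intro sin_gt_zero) simp_all
  have \<kappa>: "\<kappa> > 0" using assms(7) by (simp add: \<kappa>_def)
  have const: "2 * real m * c\<^sub>2 / (\<sigma> * (real m - 2)) = c\<^sub>2 / (\<sigma> * \<kappa>)"
    using assms(7) by (simp add: \<kappa>_def)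
  define C where "C = 1 + c\<^sub>2 / (\<sigma> * \<kappa>)"
  have C: "C > 0" using \<sigma> \<kappa> assms(9) by (simp add: C_def add_pos_pos)
  have wH: "w\<^sub>H \<in> S0 T M\<^sub>H" using assms(14) by (simp add: mixed_solution_def)
  have bound: "dual_norm T (dual_minus T w w\<^sub>H) \<le> C * dual_norm T (dual_minus T w v)" if v: "v \<in> S0 T M\<^sub>H" for v
  proof -
    let ?d = "diff_bd v w\<^sub>H" and ?e = "dual_norm T (dual_minus T w v)"
    have d: "?d \<in> S0 T M\<^sub>H" by (rule S0_diff[OF K(2) MH v wH])
    have "\<sigma> * norm_bd T (primitive_bd ?d) \<le> norm_bd T (single_layer L ?d)"
      unfolding \<sigma>_def by (rule primitive_le_single_layer[OF S0_L2[OF d] assms(1-3)])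
    then have "\<kappa> * (\<sigma> * norm_bd T (primitive_bd ?d)) \<le> \<kappa> * norm_bd T (single_layer L ?d)"
      using \<kappa> by (intro mult_left_mono) auto
    also have "\<dots> \<le> norm_bd T (diff_bd g (single_layer L v))"
      unfolding \<kappa>_def by (rule mixed_solution_stability[OF K(2,3) r assms(7) MH Mh assms(11,14) v])
    \<comment> \<open>g - V v is the value of the extended operator at w - v.\<close>
    also have "\<dots> \<le> c\<^sub>2 * ?e"
      by (rule assms(10)[OF single_layer_ext_minus[OF assms(13) S0_L2[OF v] L0]])
    finally have "norm_bd T (primitive_bd ?d) \<le> c\<^sub>2 / (\<sigma> * \<kappa>) * ?e"
      using \<sigma> \<kappa> by (simp add: field_simps)
    moreover have "dual_norm T (dual_minus T w w\<^sub>H) \<le> ?e + norm_bd T (primitive_bd ?d)"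
      by (rule dual_norm_triangle[OF \<open>T > 0\<close> dual_minus_H1_dual[OF assms(12) S0_L2[OF v]] S0_L2[OF v] S0_L2[OF wH]])
    ultimately show ?thesis by (simp add: C_def algebra_simps)
  qed
  \<comment> \<open>Division by the positive \<open>C\<close> gives a lower bound of all
    competitors. \<open>w\<^sub>H\<close> itself shows that there are some.\<close>
  have "dual_norm T (dual_minus T w w\<^sub>H) / C \<le> (INF v \<in> S0 T M\<^sub>H. dual_norm T (dual_minus T w v))"
    using wH bound C by (intro cINF_greatest) (auto simp: pos_divide_le_eq mult.commute)
  then have "dual_norm T (dual_minus T w w\<^sub>H) \<le> C * (INF v \<in> S0 T M\<^sub>H. dual_norm T (dual_minus T w v))"
    using C by (simp add: pos_divide_le_eq mult.commute)
  then show ?thesis using const by (simp add: C_def \<sigma>_def)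
qed

end
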